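(* Let $a,b\in\mathbb R$ and $T>0$. Let $(Z_t)_{t\ge0}$ be the linear process given by the stochastic differential equation $$\mathrm dZ_t=\big(q(t)Z_t+r(t)\big)\,\mathrm dt+\sigma(t)\,\mathrm dB_t,\qquad t\ge0,$$ with initial condition $Z_0=0$, and suppose that $\sigma(t)\ne0$ for all $t\ge0$. Put $\widetilde R(s,t):=\gamma(s,t)\,e^{\bar q(s)-\bar q(t)}$ for $0\le s\le t\le T$. Then the process $(Y_t)_{t\in[0,T]}$ given by $$Y_t:=a\,\frac{\widetilde R(t,T)}{\widetilde R(0,T)}+Z_t-\frac{\widetilde R(0,t)}{\widetilde R(0,T)}(Z_T-b),\qquad t\in[0,T],$$ equals in law the linear process bridge $(U_t)_{t\in[0,T]}$ from $a$ to $b$ over $[0,T]$ derived from the process $Z$. Moreover, $$\widetilde R(s,t)=e^{\bar q(s)-\bar q(t)}R(t,t)-e^{\bar q(t)-\bar q(s)}R(s,s),\qquad 0\le s\le t\le T,$$ where $R$ denotes the covariance function of $Z$, and $$Y_t=a\left(e^{\bar q(t)}-e^{2\bar q(T)-\bar q(t)}\frac{\gamma(0,t)}{\gamma(0,T)}\right)+b\,e^{\bar q(T)-\bar q(t)}\frac{\gamma(0,t)}{\gamma(0,T)}+\left(Z_t-e^{\bar q(T)-\bar q(t)}\frac{\gamma(0,t)}{\gamma(0,T)}Z_T\right),\qquad t\in[0,T].$$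
   Context: $q,\sigma,r:\mathbb R_+\to\mathbb R$ are continuous functions, $(B_t)_{t\ge0}$ is a standard Wiener process, and $\bar q(t):=\int_0^tq(u)\,\mathrm du$. For $0\le s\le t$ and $x\in\mathbb R$, $$m_x(s,t):=e^{\bar q(t)-\bar q(s)}x+\int_s^te^{\bar q(t)-\bar q(u)}r(u)\,\mathrm du,\qquad \gamma(s,t):=\int_s^te^{2(\bar q(t)-\bar q(u))}\sigma^2(u)\,\mathrm du.$$ For $0\le s\le t<T$, $$n_{a,b}(s,t):=\frac{\gamma(s,t)}{\gamma(s,T)}\,e^{\bar q(T)-\bar q(t)}\left(b-\int_t^Te^{\bar q(T)-\bar q(u)}r(u)\,\mathrm du\right)+\frac{\gamma(t,T)}{\gamma(s,T)}\,m_a(s,t).$$ The linear process bridge from $a$ to $b$ over $[0,T]$ derived from $Z$ is the almost surely continuous process $(U_t)_{t\in[0,T]}$ with $$U_t=n_{a,b}(0,t)+\int_0^t\frac{\gamma(t,T)}{\gamma(s,T)}\,e^{\bar q(t)-\bar q(s)}\sigma(s)\,\mathrm dB_s,\quad t\in[0,T),\qquad U_T=b.$$ The covariance function of $Z$ is $R(s,t)=\mathrm{Cov}(Z_s,Z_t)$. "Equals in law" means having the same finite-dimensional distributions (equivalently, for almost surely continuous processes, the same law on the space of continuous functions on $[0,T]$). *)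

theory Defs
  imports "HOL-Probability.Probability"
begin

text \<open>Processes are maps \<open>real \<Rightarrow> 'w \<Rightarrow> real\<close> (time first); only the times in \<open>{0..}\<close>,
  respectively \<open>{0..T}\<close>, are ever constrained.\<close>

locale standard_wiener_process = prob_space M for M :: "'w measure" +
  fixes B :: "real \<Rightarrow> 'w \<Rightarrow> real"
  assumes random_variable: "\<And>t. 0 \<le> t \<Longrightarrow> B t \<in> borel_measurable M"
    and starts_at_0: "AE \<omega> in M. B 0 \<omega> = 0"
    and normal_increments: "\<And>s t. 0 \<le> s \<Longrightarrow> s < t \<Longrightarrow>
      distributed M lborel (\<lambda>\<omega>. B t \<omega> - B s \<omega>) (normal_density 0 (sqrt (t - s)))"
    and independent_increments: "\<And>(\<tau> :: nat \<Rightarrow> real) n. 0 \<le> \<tau> 0 \<Longrightarrow> strict_mono_on {..n} \<tau> \<Longrightarrow>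
      indep_vars (\<lambda>_. borel) (\<lambda>i \<omega>. B (\<tau> (Suc i)) \<omega> - B (\<tau> i) \<omega>) {..<n}"
    and continuous_paths: "AE \<omega> in M. continuous_on {0..} (\<lambda>t. B t \<omega>)"

definition step_fun :: "nat \<Rightarrow> (nat \<Rightarrow> real) \<Rightarrow> (nat \<Rightarrow> real) \<Rightarrow> real \<Rightarrow> real" where
  "step_fun n \<tau> c u = (\<Sum>i<n. c i * indicator {\<tau> i<..\<tau> (Suc i)} u)"

definition step_integral ::
  "(real \<Rightarrow> 'w \<Rightarrow> real) \<Rightarrow> nat \<Rightarrow> (nat \<Rightarrow> real) \<Rightarrow> (nat \<Rightarrow> real) \<Rightarrow> 'w \<Rightarrow> real" where
  "step_integral B n \<tau> c \<omega> = (\<Sum>i<n. c i * (B (\<tau> (Suc i)) \<omega> - B (\<tau> i) \<omega>))"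

text \<open>\<open>I\<close> is a version of the stochastic integral of the deterministic integrand \<open>f\<close> with respect
  to \<open>B\<close> over \<open>[0,t]\<close>: the \<open>L\<^sup>2\<close> limit of the integrals of step functions that approximate \<open>f\<close>
  in \<open>L\<^sup>2[0,t]\<close>. All integrands in linear equations with additive noise and in the integral
  representation of the bridge are deterministic, so no general Ito integral is needed. The
  \<open>L\<^sup>2\<close> distances are nonnegative integrals, so that a non-square-integrable difference has
  distance \<open>\<infinity>\<close> and not \<open>0\<close>.\<close>
definition has_wiener_integral ::
  "'w measure \<Rightarrow> (real \<Rightarrow> 'w \<Rightarrow> real) \<Rightarrow> (real \<Rightarrow> real) \<Rightarrow> real \<Rightarrow> ('w \<Rightarrow> real) \<Rightarrow> bool" where
  "has_wiener_integral M B f t I \<longleftrightarrow>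
     I \<in> borel_measurable M \<and>
     (\<exists>(n :: nat \<Rightarrow> nat) (\<tau> :: nat \<Rightarrow> nat \<Rightarrow> real) (c :: nat \<Rightarrow> nat \<Rightarrow> real).
        (\<forall>k. mono_on {..n k} (\<tau> k) \<and> 0 \<le> \<tau> k 0 \<and> \<tau> k (n k) \<le> t) \<and>
        (\<lambda>k. \<integral>\<^sup>+u\<in>{0..t}. ennreal ((f u - step_fun (n k) (\<tau> k) (c k) u)\<^sup>2) \<partial>lborel) \<longlonglongrightarrow> 0 \<and>
        (\<lambda>k. \<integral>\<^sup>+\<omega>. ennreal ((I \<omega> - step_integral B (n k) (\<tau> k) (c k) \<omega>)\<^sup>2) \<partial>M) \<longlonglongrightarrow> 0)"

text \<open>A continuous solution of \<open>dZ\<^sub>t = (q(t) Z\<^sub>t + r(t)) dt + \<sigma>(t) dB\<^sub>t\<close>. Adaptedness is not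
  demanded: the stochastic integral has a deterministic integrand, so the equation makes sense
  without it.\<close>
definition linear_sde_solution ::
  "'w measure \<Rightarrow> (real \<Rightarrow> 'w \<Rightarrow> real) \<Rightarrow> (real \<Rightarrow> real) \<Rightarrow> (real \<Rightarrow> real) \<Rightarrow> (real \<Rightarrow> real) \<Rightarrow>
     (real \<Rightarrow> 'w \<Rightarrow> real) \<Rightarrow> bool" where
  "linear_sde_solution M B q r \<sigma> Z \<longleftrightarrow>
     (\<forall>t\<ge>0. Z t \<in> borel_measurable M) \<and>
     (AE \<omega> in M. continuous_on {0..} (\<lambda>t. Z t \<omega>)) \<and>
     (\<forall>t\<ge>0. \<exists>I. has_wiener_integral M B \<sigma> t I \<and>
        (AE \<omega> in M. Z t \<omega> = Z 0 \<omega> + integral {0..t} (\<lambda>u. q u * Z u \<omega> + r u) + I \<omega>))"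

definition qbar :: "(real \<Rightarrow> real) \<Rightarrow> real \<Rightarrow> real" where
  "qbar q t = integral {0..t} q"

definition cond_mean ::
  "(real \<Rightarrow> real) \<Rightarrow> (real \<Rightarrow> real) \<Rightarrow> real \<Rightarrow> real \<Rightarrow> real \<Rightarrow> real" where
  "cond_mean q r x s t =
     exp (qbar q t - qbar q s) * x + integral {s..t} (\<lambda>u. exp (qbar q t - qbar q u) * r u)"

definition cond_var :: "(real \<Rightarrow> real) \<Rightarrow> (real \<Rightarrow> real) \<Rightarrow> real \<Rightarrow> real \<Rightarrow> real" where
  "cond_var q \<sigma> s t = integral {s..t} (\<lambda>u. exp (2 * (qbar q t - qbar q u)) * (\<sigma> u)\<^sup>2)"

definition bridge_mean ::
  "(real \<Rightarrow> real) \<Rightarrow> (real \<Rightarrow> real) \<Rightarrow> (real \<Rightarrow> real) \<Rightarrow> real \<Rightarrow> real \<Rightarrow> real \<Rightarrow>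
     real \<Rightarrow> real \<Rightarrow> real" where
  "bridge_mean q r \<sigma> T a b s t =
     cond_var q \<sigma> s t / cond_var q \<sigma> s T * exp (qbar q T - qbar q t)
       * (b - integral {t..T} (\<lambda>u. exp (qbar q T - qbar q u) * r u))
     + cond_var q \<sigma> t T / cond_var q \<sigma> s T * cond_mean q r a s t"

definition Rtilde :: "(real \<Rightarrow> real) \<Rightarrow> (real \<Rightarrow> real) \<Rightarrow> real \<Rightarrow> real \<Rightarrow> real" where
  "Rtilde q \<sigma> s t = cond_var q \<sigma> s t * exp (qbar q s - qbar q t)"

definition linear_process_bridge ::
  "'w measure \<Rightarrow> (real \<Rightarrow> 'w \<Rightarrow> real) \<Rightarrow> (real \<Rightarrow> real) \<Rightarrow> (real \<Rightarrow> real) \<Rightarrow> (real \<Rightarrow> real) \<Rightarrow>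
     real \<Rightarrow> real \<Rightarrow> real \<Rightarrow> (real \<Rightarrow> 'w \<Rightarrow> real) \<Rightarrow> bool" where
  "linear_process_bridge M B q r \<sigma> T a b U \<longleftrightarrow>
     (\<forall>t\<in>{0..T}. U t \<in> borel_measurable M) \<and>
     (AE \<omega> in M. continuous_on {0..T} (\<lambda>t. U t \<omega>)) \<and>
     (\<forall>t\<in>{0..<T}. \<exists>I.
        has_wiener_integral M B
          (\<lambda>s. cond_var q \<sigma> t T / cond_var q \<sigma> s T * exp (qbar q t - qbar q s) * \<sigma> s) t I \<and>
        (AE \<omega> in M. U t \<omega> = bridge_mean q r \<sigma> T a b 0 t + I \<omega>)) \<and>
     (AE \<omega> in M. U T \<omega> = b)"

definition covariance_fun :: "'w measure \<Rightarrow> (real \<Rightarrow> 'w \<Rightarrow> real) \<Rightarrow> real \<Rightarrow> real \<Rightarrow> real" where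
  "covariance_fun M X s t =
     (\<integral>\<omega>. (X s \<omega> - (\<integral>\<omega>'. X s \<omega>' \<partial>M)) * (X t \<omega> - (\<integral>\<omega>'. X t \<omega>' \<partial>M)) \<partial>M)"

text \<open>Equality of all finite-dimensional distributions of \<open>X\<close> (on \<open>M\<close>) and \<open>Y\<close> (on \<open>N\<close>).\<close>
definition equal_in_law ::
  "real set \<Rightarrow> 'v measure \<Rightarrow> (real \<Rightarrow> 'v \<Rightarrow> real) \<Rightarrow> 'w measure \<Rightarrow> (real \<Rightarrow> 'w \<Rightarrow> real) \<Rightarrow> bool" where
  "equal_in_law A M X N Y \<longleftrightarrow>
     (\<forall>t\<in>A. X t \<in> borel_measurable M) \<and> (\<forall>t\<in>A. Y t \<in> borel_measurable N) \<and>
     (\<forall>J. finite J \<and> J \<subseteq> A \<longrightarrow>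
        distr M (\<Pi>\<^sub>M t\<in>J. borel) (\<lambda>\<omega>. \<lambda>t\<in>J. X t \<omega>) =
        distr N (\<Pi>\<^sub>M t\<in>J. borel) (\<lambda>\<omega>. \<lambda>t\<in>J. Y t \<omega>))"

end

(*
  Every random variable involved is a Wiener integral of a deterministic integrand, shifted by a constant.
  Integration by parts along the paths of the equation gives
    exp(-qbar t) (Z_t - m_0(0,t)) = int_0^t kappa dB,   kappa u = exp(-qbar u) sigma u,
  so Y_t and U_t have the same mean, and their centred parts are Wiener integrals of explicit multiples of
  kappa. With v t = int_0^t kappa^2 both families of integrands have the inner products
    exp(qbar s + qbar t) v(s) (v T - v t) / v T   (s <= t),
  for the bridge because c / (v T - v) is an antiderivative of c kappa^2 / (v T - v)^2. Hence all linear
  combinations have the same characteristic functions, and these determine the joint laws.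
*)
theory Submission
  imports Defs
begin

section \<open>Characteristic functions determine joint laws\<close>

text \<open>The equation supplies its stochastic integral only as some version at each single time,
  with an exceptional null set depending on that time, so no path of the integral is at hand.
  \<open>Z t\<close> is therefore identified along uniform grids, whose points are countably many:
  there the weighted increments of the integral are expressed through the continuous path of
  \<open>Z\<close>, and since the weight \<open>exp (- qbar q t)\<close> is differentiable they
  converge by ordinary integration by parts, without an Ito correction. This limit is almost sure
  and comes without moment bounds, which is why integrals are treated as a relation closed under
  convergence in probability; Gaussianity is read off characteristic functions and moments are
  recovered from the law afterwards. The joint laws are degenerate at the end points of the
  interval, so densities cannot be compared. In the clock \<open>v\<close> both processes are scaled
  Brownian bridges, \<open>U\<close> in adapted and \<open>Y\<close> in anticipative form; \<sigma>
  \<noteq> 0 makes this clock strictly increasing, hence \<open>v T - v u\<close> positive before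
  \<open>T\<close>.\<close>

lemma char_weighted_determines_nonneg:
  fixes X :: "'v \<Rightarrow> real" and X' :: "'w \<Rightarrow> real" and h :: "'v \<Rightarrow> real" and h' :: "'w \<Rightarrow> real"
  assumes [measurable]: "X \<in> borel_measurable M" "X' \<in> borel_measurable N"
    and h: "integrable M h" "\<And>\<omega>. 0 \<le> h \<omega>" and h': "integrable N h'" "\<And>\<omega>. 0 \<le> h' \<omega>"
    and eq: "\<And>s. (CLINT \<omega>|M. h \<omega> * iexp (s * X \<omega>)) = (CLINT \<omega>|N. h' \<omega> * iexp (s * X' \<omega>))"
    and A[measurable]: "A \<in> sets borel"
  shows "(LINT \<omega>|M. h \<omega> * indicator A (X \<omega>)) = (LINT \<omega>|N. h' \<omega> * indicator A (X' \<omega>))"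
proof -
  have [measurable]: "h \<in> borel_measurable M" "h' \<in> borel_measurable N"
    using h h' by auto
  define c where "c = (LINT \<omega>|M. h \<omega>)"
  have c': "c = (LINT \<omega>|N. h' \<omega>)"
  proof -
    have "complex_of_real c = complex_of_real (LINT \<omega>|N. h' \<omega>)"
      using eq[of 0] unfolding c_def by (simp add: integral_complex_of_real)
    then show ?thesis by (simp only: of_real_eq_iff)
  qed
  show ?thesis
  proof (cases "c = 0")
    \<comment> \<open>Zero mass admits no normalisation, but it forces both weights to vanish almost
      everywhere.\<close>
    case True
    have "AE \<omega> in M. h \<omega> = 0"
      using True integral_nonneg_eq_0_iff_AE[OF h(1)] h(2) by (simp add: c_def)
    then have "(LINT \<omega>|M. h \<omega> * indicator A (X \<omega>)) = (LINT \<omega>|M. 0)"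
      by (intro integral_cong_AE) auto
    moreover have "AE \<omega> in N. h' \<omega> = 0"
      using True integral_nonneg_eq_0_iff_AE[OF h'(1)] h'(2) by (simp add: c')
    then have "(LINT \<omega>|N. h' \<omega> * indicator A (X' \<omega>)) = (LINT \<omega>|N. 0)"
      by (intro integral_cong_AE) auto
    ultimately show ?thesis by simp
  next
    case False
    then have c: "c > 0" using h(2) by (simp add: c_def order_less_le)
    \<comment> \<open>Stated for a generic measure \<open>L\<close> so that it serves both sides.
      \<open>k / c\<close> is a probability density, and the weighted integral divided by
      \<open>c\<close> is the characteristic function of \<open>V\<close> under it, so the
      one-dimensional Levy uniqueness theorem applies.\<close>
    have key: "real_distribution (distr (density L (\<lambda>\<omega>. ennreal (k \<omega> / c))) borel V)
      \<and> (\<forall>s. char (distr (density L (\<lambda>\<omega>. ennreal (k \<omega> / c))) borel V) s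
           = (CLINT \<omega>|L. k \<omega> * iexp (s * V \<omega>)) / c)
      \<and> measure (distr (density L (\<lambda>\<omega>. ennreal (k \<omega> / c))) borel V) A
           = (LINT \<omega>|L. k \<omega> * indicator A (V \<omega>)) / c"
      if [measurable]: "V \<in> borel_measurable L" and k: "integrable L k" "\<And>\<omega>. 0 \<le> k \<omega>"
        and ck: "c = (LINT \<omega>|L. k \<omega>)" for L :: "'x measure" and V :: "'x \<Rightarrow> real" and k
    proof (intro conjI allI)
      have [measurable]: "k \<in> borel_measurable L" using k by auto
      let ?P = "density L (\<lambda>\<omega>. ennreal (k \<omega> / c))"
      have "emeasure ?P (space ?P) = (\<integral>\<^sup>+\<omega>. ennreal (k \<omega> / c) \<partial>L)"
        by (simp add: emeasure_density)
      also have "\<dots> = ennreal (LINT \<omega>|L. k \<omega> / c)"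
        by (rule nn_integral_eq_integral) (use k c in auto)
      also have "\<dots> = 1" using c ck by simp
      finally interpret P: prob_space ?P by (rule prob_spaceI)
      have "prob_space (distr ?P borel V)" by (rule P.prob_space_distr) simp
      then show "real_distribution (distr ?P borel V)"
        by (simp add: real_distribution_def real_distribution_axioms_def)
      show "char (distr ?P borel V) s = (CLINT \<omega>|L. k \<omega> * iexp (s * V \<omega>)) / c" for s
      proof -
        have "char (distr ?P borel V) s = (CLINT \<omega>|L. (k \<omega> / c) *\<^sub>R iexp (s * V \<omega>))"
          unfolding char_def using k c by (simp add: integral_distr integral_density)
        also have "\<dots> = (CLINT \<omega>|L. k \<omega> * iexp (s * V \<omega>) / c)"
          by (intro Bochner_Integration.integral_cong) (auto simp: scaleR_conv_of_real)
        finally show ?thesis by simp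
      qed
      show "measure (distr ?P borel V) A = (LINT \<omega>|L. k \<omega> * indicator A (V \<omega>)) / c"
      proof -
        have "measure (distr ?P borel V) A = (LINT x|distr ?P borel V. indicator A x)"
          by simp
        also have "\<dots> = (LINT \<omega>|L. (k \<omega> / c) *\<^sub>R indicator A (V \<omega>))"
          using k c by (subst integral_distr) (auto simp: integral_density)
        also have "\<dots> = (LINT \<omega>|L. k \<omega> * indicator A (V \<omega>) / c)"
          by (intro Bochner_Integration.integral_cong) auto
        finally show ?thesis by simp
      qed
    qed
    note M = key[OF assms(1) h c_def] and N = key[OF assms(2) h' c']
    have "distr (density M (\<lambda>\<omega>. ennreal (h \<omega> / c))) borel X
        = distr (density N (\<lambda>\<omega>. ennreal (h' \<omega> / c))) borel X'"
      by (rule Levy_uniqueness) (use M N eq in auto)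
    then show ?thesis using M N c by auto
  qed
qed

text \<open>Conjugation turns the hypothesis for \<open>h\<close> into the one for \<open>cnj h\<close> (replace \<open>s\<close> by \<open>- s\<close>), so
  \<open>h\<close> may be taken real; adding a constant then makes it nonnegative.\<close>
lemma char_weighted_determines:
  fixes X :: "'v \<Rightarrow> real" and X' :: "'w \<Rightarrow> real" and h :: "'v \<Rightarrow> complex" and h' :: "'w \<Rightarrow> complex"
  assumes "finite_measure M" "finite_measure N"
    and [measurable]: "X \<in> borel_measurable M" "X' \<in> borel_measurable N"
      "h \<in> borel_measurable M" "h' \<in> borel_measurable N"
    and h: "\<And>\<omega>. norm (h \<omega>) \<le> C" and h': "\<And>\<omega>. norm (h' \<omega>) \<le> C"
    and eq: "\<And>s. (CLINT \<omega>|M. h \<omega> * iexp (s * X \<omega>)) = (CLINT \<omega>|N. h' \<omega> * iexp (s * X' \<omega>))"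
    and eq1: "\<And>s. (CLINT \<omega>|M. iexp (s * X \<omega>)) = (CLINT \<omega>|N. iexp (s * X' \<omega>))"
    and A[measurable]: "A \<in> sets borel"
  shows "(CLINT \<omega>|M. h \<omega> * indicator A (X \<omega>)) = (CLINT \<omega>|N. h' \<omega> * indicator A (X' \<omega>))"
proof -
  interpret M: finite_measure M by fact
  interpret N: finite_measure N by fact
  have iM: "integrable M f" if "f \<in> borel_measurable M" "\<And>\<omega>. norm (f \<omega>) \<le> D"
    for f :: "'v \<Rightarrow> 'c::{banach, second_countable_topology}" and D
    using that by (intro M.integrable_const_bound[where B=D]) auto
  have iN: "integrable N f" if "f \<in> borel_measurable N" "\<And>\<omega>. norm (f \<omega>) \<le> D"
    for f :: "'w \<Rightarrow> 'c::{banach, second_countable_topology}" and D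
    using that by (intro N.integrable_const_bound[where B=D]) auto
  have real: "(LINT \<omega>|M. g \<omega> * indicator A (X \<omega>)) = (LINT \<omega>|N. g' \<omega> * indicator A (X' \<omega>))"
    if [measurable]: "g \<in> borel_measurable M" "g' \<in> borel_measurable N"
      and g: "\<And>\<omega>. \<bar>g \<omega>\<bar> \<le> C" and g': "\<And>\<omega>. \<bar>g' \<omega>\<bar> \<le> C"
      and eqg: "\<And>s. (CLINT \<omega>|M. g \<omega> * iexp (s * X \<omega>)) = (CLINT \<omega>|N. g' \<omega> * iexp (s * X' \<omega>))" for g g'
  proof -
    have C: "C \<ge> 0" using order_trans[OF abs_ge_zero g] .
    have intM: "integrable M (\<lambda>\<omega>. g \<omega> * iexp (s * X \<omega>))" "integrable M (\<lambda>\<omega>. iexp (s * X \<omega>))" for s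
      by (rule iM[of _ C]; simp add: norm_mult g) (rule iM[of _ 1]; simp)
    have intN: "integrable N (\<lambda>\<omega>. g' \<omega> * iexp (s * X' \<omega>))" "integrable N (\<lambda>\<omega>. iexp (s * X' \<omega>))" for s
      by (rule iN[of _ C]; simp add: norm_mult g') (rule iN[of _ 1]; simp)
    \<comment> \<open>The weight \<open>g + C\<close> is nonnegative. Subtracting the statement for
      the constant weight \<open>C\<close>, whose hypothesis is \<open>eq1\<close>, leaves the one
      for \<open>g\<close>.\<close>
    have 1: "(LINT \<omega>|M. (g \<omega> + C) * indicator A (X \<omega>)) = (LINT \<omega>|N. (g' \<omega> + C) * indicator A (X' \<omega>))"
    proof (rule char_weighted_determines_nonneg)
      show "integrable M (\<lambda>\<omega>. g \<omega> + C)"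
        by (rule iM[of _ "C+C"]) (use g C in \<open>auto intro!: order_trans[OF abs_triangle_ineq] add_mono\<close>)
      show "integrable N (\<lambda>\<omega>. g' \<omega> + C)"
        by (rule iN[of _ "C+C"]) (use g' C in \<open>auto intro!: order_trans[OF abs_triangle_ineq] add_mono\<close>)
      show "0 \<le> g \<omega> + C" for \<omega> using g[of \<omega>] by linarith
      show "0 \<le> g' \<omega> + C" for \<omega> using g'[of \<omega>] by linarith
      show "(CLINT \<omega>|M. complex_of_real (g \<omega> + C) * iexp (s * X \<omega>)) =
          (CLINT \<omega>|N. complex_of_real (g' \<omega> + C) * iexp (s * X' \<omega>))" for s
        using intM[of s] intN[of s] eqg[of s] eq1[of s]
        by (simp add: distrib_right)
    qed auto
    have 2: "(LINT \<omega>|M. C * indicator A (X \<omega>)) = (LINT \<omega>|N. C * indicator A (X' \<omega>))"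
    proof (rule char_weighted_determines_nonneg)
      show "(CLINT \<omega>|M. complex_of_real C * iexp (s * X \<omega>)) =
          (CLINT \<omega>|N. complex_of_real C * iexp (s * X' \<omega>))" for s
        using eq1[of s] by simp
    qed (use C in auto)
    have "integrable M (\<lambda>\<omega>. g \<omega> * indicator A (X \<omega>))" "integrable M (\<lambda>\<omega>. C * indicator A (X \<omega>))"
      by (rule iM[of _ C]; use g C in \<open>auto simp: abs_mult indicator_def\<close>)+
    moreover have "integrable N (\<lambda>\<omega>. g' \<omega> * indicator A (X' \<omega>))" "integrable N (\<lambda>\<omega>. C * indicator A (X' \<omega>))"
      by (rule iN[of _ C]; use g' C in \<open>auto simp: abs_mult indicator_def\<close>)+
    ultimately show ?thesis using 1 2 by (auto simp: distrib_right)
  qed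
  have eqc: "(CLINT \<omega>|M. cnj (h \<omega>) * iexp (s * X \<omega>)) = (CLINT \<omega>|N. cnj (h' \<omega>) * iexp (s * X' \<omega>))" for s
  proof -
    have "cnj (iexp (- s * x)) = iexp (s * x)" for x
      by (simp add: exp_cnj)
    then have "(CLINT \<omega>|M. cnj (h \<omega>) * iexp (s * X \<omega>)) = cnj (CLINT \<omega>|M. h \<omega> * iexp (- s * X \<omega>))"
       "(CLINT \<omega>|N. cnj (h' \<omega>) * iexp (s * X' \<omega>)) = cnj (CLINT \<omega>|N. h' \<omega> * iexp (- s * X' \<omega>))"
      by (simp_all add: Bochner_Integration.integral_cnj[symmetric] del: Bochner_Integration.integral_cnj)
    then show ?thesis using eq[of "-s"] by simp
  qed
  have "cnj \<in> borel_measurable borel"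
    by (intro borel_measurable_continuous_onI continuous_intros)
  note [measurable] = measurable_compose[OF _ this]
  have int: "integrable M (\<lambda>\<omega>. h \<omega> * iexp (s * X \<omega>))" "integrable M (\<lambda>\<omega>. cnj (h \<omega>) * iexp (s * X \<omega>))"
    "integrable N (\<lambda>\<omega>. h' \<omega> * iexp (s * X' \<omega>))" "integrable N (\<lambda>\<omega>. cnj (h' \<omega>) * iexp (s * X' \<omega>))" for s
    by (simp_all add: iM[of _ C] iN[of _ C] norm_mult h h')
  have Re: "(LINT \<omega>|M. Re (h \<omega>) * indicator A (X \<omega>)) = (LINT \<omega>|N. Re (h' \<omega>) * indicator A (X' \<omega>))"
  proof (rule real)
    have *: "complex_of_real (Re z) * w = (z * w + cnj z * w) / 2" for z w
      by (simp add: complex_eq_iff algebra_simps)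
    show "(CLINT \<omega>|M. Re (h \<omega>) * iexp (s * X \<omega>)) = (CLINT \<omega>|N. Re (h' \<omega>) * iexp (s * X' \<omega>))" for s
      unfolding * using int[of s] eq[of s] eqc[of s] by simp
  qed (use h h' abs_Re_le_cmod order_trans in \<open>auto, blast+\<close>)
  have Im: "(LINT \<omega>|M. Im (h \<omega>) * indicator A (X \<omega>)) = (LINT \<omega>|N. Im (h' \<omega>) * indicator A (X' \<omega>))"
  proof (rule real)
    have *: "complex_of_real (Im z) * w = (z * w - cnj z * w) / (2 * \<i>)" for z w
      by (simp add: left_diff_distrib[symmetric] complex_diff_cnj, simp add: complex_eq_iff)
    show "(CLINT \<omega>|M. Im (h \<omega>) * iexp (s * X \<omega>)) = (CLINT \<omega>|N. Im (h' \<omega>) * iexp (s * X' \<omega>))" for s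
      unfolding * using int[of s] eq[of s] eqc[of s] by simp
  qed (use h h' abs_Im_le_cmod order_trans in \<open>auto, blast+\<close>)
  have "integrable M (\<lambda>\<omega>. h \<omega> * indicator A (X \<omega>))" "integrable N (\<lambda>\<omega>. h' \<omega> * indicator A (X' \<omega>))"
    by (rule iM[of _ C], (simp add: norm_mult h split: split_indicator)+)
       (use h h' order_trans[OF norm_ge_zero h] in \<open>auto intro!: iM[of _ C] iN[of _ C] simp: norm_mult split: split_indicator\<close>)
  moreover have "Re (indicator A x) = indicator A x" "Im (indicator A x) = 0" for x
    by (simp_all add: indicator_def)
  ultimately show ?thesis
    using Re Im by (simp add: complex_eq_iff integral_Re[symmetric] integral_Im[symmetric] del: integral_Re integral_Im)
qed

text \<open>Multivariate uniqueness from the one-dimensional theorem: the coordinates are converted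
  one at a time from an exponential factor into an indicator factor, while all other factors act as
  a bounded complex weight. Once every coordinate is converted, the identity compares probabilities
  of boxes, which generate the product sigma-algebra.\<close>

theorem char_determines_PiM:
  fixes X :: "'i \<Rightarrow> 'v \<Rightarrow> real" and X' :: "'i \<Rightarrow> 'w \<Rightarrow> real"
  assumes "prob_space M" "prob_space N" and J: "finite J"
    and X: "\<And>i. i \<in> J \<Longrightarrow> X i \<in> borel_measurable M"
    and X': "\<And>i. i \<in> J \<Longrightarrow> X' i \<in> borel_measurable N"
    and eq: "\<And>\<theta>. (CLINT \<omega>|M. iexp (\<Sum>i\<in>J. \<theta> i * X i \<omega>)) = (CLINT \<omega>|N. iexp (\<Sum>i\<in>J. \<theta> i * X' i \<omega>))"
  shows "distr M (\<Pi>\<^sub>M i\<in>J. borel) (\<lambda>\<omega>. \<lambda>i\<in>J. X i \<omega>) = distr N (\<Pi>\<^sub>M i\<in>J. borel) (\<lambda>\<omega>. \<lambda>i\<in>J. X' i \<omega>)"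
    (is "?P = ?Q")
proof -
  interpret M: prob_space M by fact
  interpret N: prob_space N by fact
  \<comment> \<open>\<open>K\<close> holds the coordinates already converted. The frequencies
    \<theta> stay arbitrary because the induction step varies the one at the coordinate being
    converted.\<close>
  have main: "(CLINT \<omega>|M. (\<Prod>i\<in>K. indicator (A i) (X i \<omega>)) * iexp (\<Sum>i\<in>J-K. \<theta> i * X i \<omega>))
      = (CLINT \<omega>|N. (\<Prod>i\<in>K. indicator (A i) (X' i \<omega>)) * iexp (\<Sum>i\<in>J-K. \<theta> i * X' i \<omega>))"
    if "finite K" "K \<subseteq> J" "\<And>i. i \<in> J \<Longrightarrow> A i \<in> sets borel" for K A \<theta>
    using that(1,2)
  proof (induction arbitrary: \<theta>)
    case empty
    then show ?case using eq by simp
  next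
    case (insert k K)
    have [measurable]: "X i \<in> borel_measurable M" "X' i \<in> borel_measurable N" "A i \<in> sets borel"
      if "i \<in> insert k K" for i
      using that X X' insert.prems \<open>\<And>i. i \<in> J \<Longrightarrow> A i \<in> sets borel\<close> by auto
    have [measurable]: "X i \<in> borel_measurable M" "X' i \<in> borel_measurable N" if "i \<in> J - insert k K" for i
      using that X X' by auto
    have Jk: "J - K = insert k (J - insert k K)" "finite (J - insert k K)"
      using insert J by auto
    \<comment> \<open>Everything that does not involve coordinate \<open>k\<close>: the weight of
      modulus at most 1 for \<open>char_weighted_determines\<close>.\<close>
    define h where "h \<omega> = (\<Prod>i\<in>K. indicator (A i) (X i \<omega>)) * iexp (\<Sum>i\<in>J - insert k K. \<theta> i * X i \<omega>)" for \<omega>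
    define h' where "h' \<omega> = (\<Prod>i\<in>K. indicator (A i) (X' i \<omega>)) * iexp (\<Sum>i\<in>J - insert k K. \<theta> i * X' i \<omega>)" for \<omega>
    have prod1: "norm (\<Prod>i\<in>K. indicator (A i) (z i) :: complex) \<le> 1" for z :: "'i \<Rightarrow> real"
      unfolding prod_norm[symmetric] by (rule prod_le_1) (auto simp: indicator_def)
    have "(CLINT \<omega>|M. h \<omega> * indicator (A k) (X k \<omega>)) = (CLINT \<omega>|N. h' \<omega> * indicator (A k) (X' k \<omega>))"
    proof (rule char_weighted_determines[where C=1])
      show "finite_measure M" "finite_measure N" by unfold_locales
      show "h \<in> borel_measurable M" "h' \<in> borel_measurable N"
        unfolding h_def h'_def by measurable
      show "norm (h \<omega>) \<le> 1" "norm (h' \<omega>') \<le> 1" for \<omega> \<omega>'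
        unfolding h_def h'_def using prod1 by (simp_all add: norm_mult)
      show "(CLINT \<omega>|M. h \<omega> * iexp (s * X k \<omega>)) = (CLINT \<omega>|N. h' \<omega> * iexp (s * X' k \<omega>))" for s
      proof -
        have *: "(\<Sum>i\<in>J-K. (\<theta>(k := s)) i * z i) = s * z k + (\<Sum>i\<in>J - insert k K. \<theta> i * z i)" for z
          unfolding Jk(1) using Jk(2) by (auto intro!: sum.cong)
        show ?thesis
          using insert.IH[of "\<theta>(k := s)"] insert.prems unfolding * h_def h'_def
          by (simp add: exp_add distrib_left mult_ac del: fun_upd_apply)
      qed
      show "(CLINT \<omega>|M. iexp (s * X k \<omega>)) = (CLINT \<omega>|N. iexp (s * X' k \<omega>))" for s
      proof -
        \<comment> \<open>All frequencies zero except at \<open>k\<close> give the marginal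
          characteristic function, that is, the unweighted hypothesis.\<close>
        have *: "(\<Sum>i\<in>J. (if i = k then s else 0) * z i) = s * z k" for z
          using J insert.prems by (simp add: if_distrib[where f="\<lambda>x. x * _"] sum.delta cong: if_cong)
        show ?thesis using eq[of "\<lambda>i. if i = k then s else 0"] unfolding * by simp
      qed
    qed auto
    then show ?case
      unfolding h_def h'_def using insert.hyps by (simp add: mult_ac)
  qed
  have [measurable]: "X i \<in> borel_measurable M" "X' i \<in> borel_measurable N" if "i \<in> J" for i
    using that X X' by auto
  show ?thesis
  proof (rule measure_eqI_PiM_finite[OF J])
    fix A :: "'i \<Rightarrow> real set" assume A: "\<And>i. i \<in> J \<Longrightarrow> A i \<in> sets borel"
    \<comment> \<open>The sum over \<open>J - J\<close> is empty, so the exponential factor is 1; it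
      is kept to match \<open>main\<close> at \<open>K = J\<close>.\<close>
    have em: "complex_of_real (measure (distr L (\<Pi>\<^sub>M i\<in>J. borel) (\<lambda>\<omega>. \<lambda>i\<in>J. V i \<omega>)) (Pi\<^sub>E J A))
       = (CLINT \<omega>|L. (\<Prod>i\<in>J. indicator (A i) (V i \<omega>)) * iexp (\<Sum>i\<in>J-J. 0 * V i \<omega>))"
      if [measurable]: "\<And>i. i \<in> J \<Longrightarrow> V i \<in> borel_measurable L"
      for V :: "'i \<Rightarrow> 'x \<Rightarrow> real" and L
    proof -
      let ?D = "distr L (\<Pi>\<^sub>M i\<in>J. borel) (\<lambda>\<omega>. \<lambda>i\<in>J. V i \<omega>)"
      have S: "Pi\<^sub>E J A \<in> sets (\<Pi>\<^sub>M i\<in>J. borel)" using J A by (intro sets_PiM_I_finite) auto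
      have ind: "indicator (Pi\<^sub>E J A) (\<lambda>i\<in>J. V i \<omega>) = (\<Prod>i\<in>J. indicator (A i) (V i \<omega>) :: real)" for \<omega>
        using J by (auto simp: indicator_def PiE_iff prod_zero_iff)
      have "measure ?D (Pi\<^sub>E J A) = (LINT x|?D. indicator (Pi\<^sub>E J A) x)"
        using S sets.sets_into_space[OF S] by (simp add: Int_absorb2)
      also have "\<dots> = (LINT \<omega>|L. (\<Prod>i\<in>J. indicator (A i) (V i \<omega>)))"
        using S by (subst integral_distr) (auto simp: ind)
      also have "complex_of_real \<dots> = (CLINT \<omega>|L. complex_of_real (\<Prod>i\<in>J. indicator (A i) (V i \<omega>)))"
        by (rule integral_complex_of_real[symmetric])
      also have "\<dots> = (CLINT \<omega>|L. (\<Prod>i\<in>J. indicator (A i) (V i \<omega>)) * iexp (\<Sum>i\<in>J-J. 0 * V i \<omega>))"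
        by (intro Bochner_Integration.integral_cong refl) (auto simp: of_real_prod indicator_def intro!: prod.cong)
      finally show ?thesis .
    qed
    have "measure ?P (Pi\<^sub>E J A) = measure ?Q (Pi\<^sub>E J A)"
    proof -
      have "complex_of_real (measure ?P (Pi\<^sub>E J A)) = complex_of_real (measure ?Q (Pi\<^sub>E J A))"
        using em[of X M, OF X] em[of X' N, OF X'] main[OF J subset_refl, of A "\<lambda>_. 0", OF A]
        by (simp only:)
      then show ?thesis by (simp only: of_real_eq_iff)
    qed
    moreover have "finite_measure ?P" "finite_measure ?Q"
      by (rule M.finite_measure_distr N.finite_measure_distr; measurable)+
    ultimately show "emeasure ?P (Pi\<^sub>E J A) = emeasure ?Q (Pi\<^sub>E J A)"
      by (simp add: finite_measure.emeasure_eq_measure)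
  next
    show "range (\<lambda>_::nat. \<Pi>\<^sub>E i\<in>J. UNIV::real set) \<subseteq> prod_algebra J (\<lambda>_. borel)"
      using J by (auto intro!: prod_algebraI_finite)
    interpret P: prob_space ?P by (rule M.prob_space_distr) measurable
    show "emeasure ?P (\<Pi>\<^sub>E i\<in>J. UNIV) \<noteq> \<infinity>" for i :: nat by simp
  qed (auto simp: space_PiM)
qed

section \<open>Elementary Wiener integrals\<close>

lemma power2_sum_le: "(x + y)\<^sup>2 \<le> 2 * x\<^sup>2 + 2 * y\<^sup>2" for x y :: real
  using sum_squares_bound[of x y] by (simp add: power2_sum)

lemma min_1_power2_sum_le: "min 1 ((x + y)\<^sup>2) \<le> 2 * min 1 (x\<^sup>2) + 2 * min 1 (y\<^sup>2)" for x y :: real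
  using power2_sum_le[of x y] zero_le_power2[of x] zero_le_power2[of y] by linarith

lemma min_1_power2_mult_le: "min 1 ((c * x)\<^sup>2) \<le> max 1 (c\<^sup>2) * min 1 (x\<^sup>2)" for c x :: real
proof -
  have "c\<^sup>2 * x\<^sup>2 \<le> max 1 (c\<^sup>2) * x\<^sup>2" by (intro mult_right_mono) auto
  then show ?thesis by (auto simp: min_def power_mult_distrib)
qed

text \<open>The left side is at most both \<open>\<bar>x - y\<bar>\<close> and 2. A plain Chebyshev
  argument would give the factor \<open>1 / \<delta>\<^sup>2\<close>; using the Lipschitz bound also
  for distances between \<delta> and 1 improves it to \<open>1 / \<delta>\<close>, so that a mean
  truncated square of order \<open>\<delta>\<^sup>2\<close> yields a total of order
  \<delta>.\<close>

lemma cmod_iexp_diff_le: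
  assumes "0 < \<delta>" "\<delta> \<le> 1"
  shows "cmod (iexp x - iexp y) \<le> 2 * \<delta> + 2 / \<delta> * min 1 ((x - y)\<^sup>2)"
proof -
  have "iexp x - iexp y = iexp y * (iexp (x - y) - 1)"
    by (simp add: algebra_simps flip: exp_add)
  then have eq: "cmod (iexp x - iexp y) = cmod (iexp (x - y) - 1)"
    by (simp add: norm_mult)
  have le2: "cmod (iexp (x - y) - 1) \<le> 2"
    using norm_triangle_ineq4[of "iexp (x - y)" 1] by simp
  have le: "cmod (iexp (x - y) - 1) \<le> \<bar>x - y\<bar>"
    using iexp_approx1[of "x - y" 0] by simp
  consider "\<bar>x - y\<bar> \<le> \<delta>" | "\<delta> < \<bar>x - y\<bar>" "\<bar>x - y\<bar> \<le> 1" | "1 < \<bar>x - y\<bar>" by linarith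
  then show ?thesis
  proof cases
    case 1
    have "0 \<le> 2 / \<delta> * min 1 ((x - y)\<^sup>2)" using assms by simp
    then show ?thesis using 1 eq le assms by linarith
  next
    case 2
    have "\<bar>x - y\<bar> * \<delta> \<le> \<bar>x - y\<bar> * \<bar>x - y\<bar>" using 2 by (intro mult_left_mono) auto
    then have "\<bar>x - y\<bar> \<le> (x - y)\<^sup>2 / \<delta>" using assms by (simp add: field_simps power2_eq_square)
    moreover have "min 1 ((x - y)\<^sup>2) = (x - y)\<^sup>2"
      using 2 by (simp add: min_def abs_square_le_1 eq_iff)
    moreover have "0 \<le> (x - y)\<^sup>2 / \<delta>" using assms by simp
    ultimately show ?thesis using eq le assms by simp
  next
    case 3
    then have "min 1 ((x - y)\<^sup>2) = 1" using abs_square_le_1[of "x - y"] by linarith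
    moreover have "2 \<le> 2 / \<delta>" using assms by (simp add: field_simps)
    ultimately show ?thesis using eq le2 assms by simp
  qed
qed

lemma sum_indicator_grid:
  fixes \<tau> :: "nat \<Rightarrow> real"
  assumes "mono_on {..n} \<tau>"
  shows "(\<Sum>i<n. indicator {\<tau> i<..\<tau> (Suc i)} u) = (indicator {\<tau> 0<..\<tau> n} u :: real)"
  using assms
proof (induction n)
  case (Suc n)
  have "mono_on {..n} \<tau>" using Suc.prems by (rule mono_on_subset) auto
  moreover have "\<tau> 0 \<le> \<tau> n" "\<tau> n \<le> \<tau> (Suc n)"
    using mono_onD[OF Suc.prems] by auto
  ultimately show ?case using Suc.IH by (auto simp: indicator_def)
qed simp

section \<open>Step functions paired with their integrals\<close>

context standard_wiener_process
begin

text \<open>Integrand and integral are kept as a pair, so no integral operator has to be shown well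
  defined. Indexing by end points instead of cells makes sums a matter of uniting two finite sets,
  with no common refinement of partitions. \<open>B 0\<close> is subtracted because it vanishes only
  almost surely.\<close>

definition elementary :: "(real \<Rightarrow> real) \<Rightarrow> ('w \<Rightarrow> real) \<Rightarrow> bool" where
  "elementary g S \<longleftrightarrow> (\<exists>F c. finite F \<and> F \<subseteq> {0..} \<and>
     g = (\<lambda>u. \<Sum>t\<in>F. c t * indicator {0<..t} u) \<and> S = (\<lambda>\<omega>. \<Sum>t\<in>F. c t * (B t \<omega> - B 0 \<omega>)))"

lemma elementary_measurable:
  assumes "elementary g S"
  shows "g \<in> borel_measurable lborel" "S \<in> borel_measurable M"
  using assms random_variable unfolding elementary_def by (auto intro!: borel_measurable_sum)

lemma elementary_zero: "elementary (\<lambda>_. 0) (\<lambda>_. 0)"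
  unfolding elementary_def by (rule exI[of _ "{}"]) simp

lemma elementary_scale:
  assumes "elementary g S"
  shows "elementary (\<lambda>u. d * g u) (\<lambda>\<omega>. d * S \<omega>)"
proof -
  obtain F c where "finite F" "F \<subseteq> {0..}" "g = (\<lambda>u. \<Sum>t\<in>F. c t * indicator {0<..t} u)"
    "S = (\<lambda>\<omega>. \<Sum>t\<in>F. c t * (B t \<omega> - B 0 \<omega>))"
    using assms unfolding elementary_def by auto
  then show ?thesis
    unfolding elementary_def
    by (intro exI[of _ F] exI[of _ "\<lambda>t. d * c t"] conjI) (simp_all only: sum_distrib_left mult.assoc)
qed

lemma elementary_add:
  assumes "elementary g S" "elementary h R"
  shows "elementary (\<lambda>u. g u + h u) (\<lambda>\<omega>. S \<omega> + R \<omega>)"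
proof -
  obtain F c where F: "finite F" "F \<subseteq> {0..}" "g = (\<lambda>u. \<Sum>t\<in>F. c t * indicator {0<..t} u)"
    "S = (\<lambda>\<omega>. \<Sum>t\<in>F. c t * (B t \<omega> - B 0 \<omega>))"
    using assms(1) unfolding elementary_def by auto
  obtain G d where G: "finite G" "G \<subseteq> {0..}" "h = (\<lambda>u. \<Sum>t\<in>G. d t * indicator {0<..t} u)"
    "R = (\<lambda>\<omega>. \<Sum>t\<in>G. d t * (B t \<omega> - B 0 \<omega>))"
    using assms(2) unfolding elementary_def by auto
  have eq: "(\<Sum>t\<in>F. c t * k t) + (\<Sum>t\<in>G. d t * k t)
    = (\<Sum>t\<in>F \<union> G. ((if t \<in> F then c t else 0) + (if t \<in> G then d t else 0)) * k t)" for k :: "real \<Rightarrow> real"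
  proof -
    have "(\<Sum>t\<in>F. c t * k t) = (\<Sum>t\<in>F \<union> G. (if t \<in> F then c t else 0) * k t)"
      using F(1) G(1) by (intro sum.mono_neutral_cong_left) auto
    moreover have "(\<Sum>t\<in>G. d t * k t) = (\<Sum>t\<in>F \<union> G. (if t \<in> G then d t else 0) * k t)"
      using F(1) G(1) by (intro sum.mono_neutral_cong_left) auto
    ultimately show ?thesis by (simp add: distrib_right sum.distrib)
  qed
  show ?thesis
    unfolding elementary_def F(3,4) G(3,4) eq
    using F(1,2) G(1,2)
    by (intro exI[of _ "F \<union> G"] exI[of _ "\<lambda>t. (if t \<in> F then c t else 0) + (if t \<in> G then d t else 0)"]) auto
qed

lemma elementary_sum:
  assumes "\<And>i. i \<in> A \<Longrightarrow> elementary (g i) (S i)"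
  shows "elementary (\<lambda>u. \<Sum>i\<in>A. g i u) (\<lambda>\<omega>. \<Sum>i\<in>A. S i \<omega>)"
  using assms
  by (induction A rule: infinite_finite_induct) (auto intro: elementary_zero elementary_add)

lemma elementary_increment:
  assumes "0 \<le> s" "s \<le> t"
  shows "elementary (indicator {s<..t}) (\<lambda>\<omega>. B t \<omega> - B s \<omega>)"
proof -
  have one: "elementary (\<lambda>u. indicator {0<..t} u) (\<lambda>\<omega>. B t \<omega> - B 0 \<omega>)" if "0 \<le> t" for t
    unfolding elementary_def by (rule exI[of _ "{t}"], rule exI[of _ "\<lambda>_. 1"]) (use that in auto)
  have "elementary (\<lambda>u. indicator {0<..t} u + (-1) * indicator {0<..s} u)
      (\<lambda>\<omega>. (B t \<omega> - B 0 \<omega>) + (-1) * (B s \<omega> - B 0 \<omega>))"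
    by (intro elementary_add elementary_scale one) (use assms in auto)
  moreover have "(\<lambda>u. indicator {0<..t} u + (-1) * indicator {0<..s} u) = (indicator {s<..t} :: real \<Rightarrow> real)"
    using assms by (auto simp: fun_eq_iff indicator_def)
  ultimately show ?thesis by simp
qed

lemma elementary_step:
  assumes "mono_on {..n} \<tau>" "0 \<le> \<tau> 0"
  shows "elementary (step_fun n \<tau> c) (step_integral B n \<tau> c)"
proof -
  have "0 \<le> \<tau> i \<and> \<tau> i \<le> \<tau> (Suc i)" if "i < n" for i
    using mono_onD[OF assms(1), of 0 i] mono_onD[OF assms(1), of i "Suc i"] assms(2) that by simp
  then have "elementary (\<lambda>u. \<Sum>i<n. c i * indicator {\<tau> i<..\<tau> (Suc i)} u)
     (\<lambda>\<omega>. \<Sum>i<n. c i * (B (\<tau> (Suc i)) \<omega> - B (\<tau> i) \<omega>))"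
    by (intro elementary_sum elementary_scale elementary_increment) auto
  then show ?thesis unfolding step_fun_def[abs_def] step_integral_def[abs_def] .
qed

text \<open>Independence of increments is available along strictly increasing grids only, so the end
  points must be sorted. The induction inserts the largest end point last, which appends a single
  cell to the grid.\<close>

lemma elementary_imp_step:
  assumes "elementary g S"
  obtains n \<tau> d where "strict_mono_on {..n} \<tau>" "0 \<le> \<tau> 0" "g = step_fun n \<tau> d" "S = step_integral B n \<tau> d"
proof -
  obtain F c where F: "finite F" "F \<subseteq> {0..}" "g = (\<lambda>u. \<Sum>t\<in>F. c t * indicator {0<..t} u)"
    "S = (\<lambda>\<omega>. \<Sum>t\<in>F. c t * (B t \<omega> - B 0 \<omega>))"
    using assms unfolding elementary_def by auto
  \<comment> \<open>The first and last grid points are part of the induction claim: the next end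
    point then lies beyond the grid, and the enlarged grid covers exactly the interval from 0 to
    it.\<close>
  have "\<exists>n \<tau> d. strict_mono_on {..n} \<tau> \<and> \<tau> 0 = 0 \<and> \<tau> n = Max (insert 0 F) \<and>
     (\<forall>u. (\<Sum>t\<in>F. c t * indicator {0<..t} u) = step_fun n \<tau> d u) \<and>
     (\<forall>\<omega>. (\<Sum>t\<in>F. c t * (B t \<omega> - B 0 \<omega>)) = step_integral B n \<tau> d \<omega>)"
    using F(1,2)
  proof (induction rule: finite_linorder_max_induct)
    case empty
    show ?case
      by (intro exI[of _ 0] exI[of _ "\<lambda>_. 0"]) (auto simp: step_fun_def step_integral_def strict_mono_on_def)
  next
    case (insert b F)
    then obtain n \<tau> d where IH: "strict_mono_on {..n} \<tau>" "\<tau> 0 = 0" "\<tau> n = Max (insert 0 F)"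
      "\<And>u. (\<Sum>t\<in>F. c t * indicator {0<..t} u) = step_fun n \<tau> d u"
      "\<And>\<omega>. (\<Sum>t\<in>F. c t * (B t \<omega> - B 0 \<omega>)) = step_integral B n \<tau> d \<omega>"
      by auto
    have b: "b \<notin> F" using insert.hyps by auto
    show ?case
    proof (cases "b = 0")
      \<comment> \<open>Adding a cell would break strict monotonicity, but the interval from 0 to 0
        is empty and its increment is 0, so the old grid still serves.\<close>
      case True
      then have "F = {}" using insert by force
      then show ?thesis
        using IH True by (intro exI[of _ n] exI[of _ \<tau>] exI[of _ d]) (auto simp: b)
    next
      case False
      define \<tau>' where "\<tau>' = \<tau>(Suc n := b)"
      \<comment> \<open>The interval from 0 to \<open>b\<close> covers every cell, hence
        \<open>c b\<close> is added to all coefficients, including that of the new last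
        cell.\<close>
      define d' where "d' i = (if i < n then d i else 0) + c b" for i
      have lt: "\<tau> n < b" using IH(3) insert False by auto
      have sm: "strict_mono_on {..Suc n} \<tau>'"
      proof (rule strict_mono_onI)
        fix i j assume ij: "i \<in> {..Suc n}" "j \<in> {..Suc n}" "i < j"
        show "\<tau>' i < \<tau>' j"
        proof (cases "j = Suc n")
          case True
          have "\<tau> i \<le> \<tau> n" using ij True strict_mono_on_leD[OF IH(1), of i n] by auto
          then show ?thesis using True ij lt by (simp add: \<tau>'_def)
        next
          case False
          then show ?thesis using ij strict_mono_onD[OF IH(1), of i j] by (simp add: \<tau>'_def)
        qed
      qed
      have Max: "Max (insert 0 (insert b F)) = b"
        using insert False by (intro Max_eqI) (auto simp: less_imp_le)
      have "(\<Sum>t\<in>insert b F. c t * indicator {0<..t} u) = step_fun (Suc n) \<tau>' d' u" for u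
      proof -
        have "step_fun (Suc n) \<tau>' d' u = (\<Sum>i<Suc n. (if i < n then d i * indicator {\<tau> i<..\<tau> (Suc i)} u else 0))
            + c b * (\<Sum>i<Suc n. indicator {\<tau>' i<..\<tau>' (Suc i)} u)"
          unfolding step_fun_def sum_distrib_left sum.distrib[symmetric]
          by (intro sum.cong) (auto simp: d'_def \<tau>'_def algebra_simps)
        also have "\<dots> = step_fun n \<tau> d u + c b * indicator {0<..b} u"
          using sum_indicator_grid[OF strict_mono_on_imp_mono_on[OF sm], of u] IH(2)
          by (simp add: step_fun_def) (simp add: \<tau>'_def)
        finally show ?thesis using IH(4)[of u] insert.hyps b by (simp del: sum_mult_indicator)
      qed
      moreover have "(\<Sum>t\<in>insert b F. c t * (B t \<omega> - B 0 \<omega>)) = step_integral B (Suc n) \<tau>' d' \<omega>" for \<omega>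
      proof -
        have "step_integral B (Suc n) \<tau>' d' \<omega> = (\<Sum>i<Suc n. (if i < n then d i * (B (\<tau> (Suc i)) \<omega> - B (\<tau> i) \<omega>) else 0))
            + c b * (\<Sum>i<Suc n. B (\<tau>' (Suc i)) \<omega> - B (\<tau>' i) \<omega>)"
          unfolding step_integral_def sum_distrib_left sum.distrib[symmetric]
          by (intro sum.cong) (auto simp: d'_def \<tau>'_def algebra_simps)
        also have "\<dots> = step_integral B n \<tau> d \<omega> + c b * (B b \<omega> - B 0 \<omega>)"
          using IH(2) sum_lessThan_telescope[of "\<lambda>i. B (\<tau>' i) \<omega>" "Suc n"]
          by (simp add: step_integral_def) (simp add: \<tau>'_def)
        finally show ?thesis using IH(5) insert.hyps b by simp
      qed
      moreover have "\<tau>' 0 = 0" "\<tau>' (Suc n) = b" using IH(2) by (auto simp: \<tau>'_def)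
      ultimately have "strict_mono_on {..Suc n} \<tau>' \<and> \<tau>' 0 = 0 \<and> \<tau>' (Suc n) = Max (insert 0 (insert b F)) \<and>
         (\<forall>u. (\<Sum>t\<in>insert b F. c t * indicator {0<..t} u) = step_fun (Suc n) \<tau>' d' u) \<and>
         (\<forall>\<omega>. (\<Sum>t\<in>insert b F. c t * (B t \<omega> - B 0 \<omega>)) = step_integral B (Suc n) \<tau>' d' \<omega>)"
        using sm Max by simp
      then show ?thesis by blast
    qed
  qed
  then obtain n \<tau> d where "strict_mono_on {..n} \<tau>" "\<tau> 0 = 0"
     "\<And>u. (\<Sum>t\<in>F. c t * indicator {0<..t} u) = step_fun n \<tau> d u"
     "\<And>\<omega>. (\<Sum>t\<in>F. c t * (B t \<omega> - B 0 \<omega>)) = step_integral B n \<tau> d \<omega>"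
    by blast
  then show ?thesis using that[of n \<tau> d] unfolding F(3,4) fun_eq_iff by simp
qed

lemma step_fun_power2:
  assumes "mono_on {..n} \<tau>"
  shows "(step_fun n \<tau> d u)\<^sup>2 = (\<Sum>i<n. (d i)\<^sup>2 * indicator {\<tau> i<..\<tau> (Suc i)} u)"
proof -
  have disj: "indicator {\<tau> i<..\<tau> (Suc i)} u * indicator {\<tau> j<..\<tau> (Suc j)} u = (0::real)"
    if "i < n" "j < n" "i < j" for i j
    using mono_onD[OF assms, of "Suc i" j] that by (auto simp: indicator_def)
  have "(step_fun n \<tau> d u)\<^sup>2 = (\<Sum>i<n. \<Sum>j<n. (d i * indicator {\<tau> i<..\<tau> (Suc i)} u) * (d j * indicator {\<tau> j<..\<tau> (Suc j)} u))"
    unfolding step_fun_def power2_eq_square sum_product ..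
  also have "\<dots> = (\<Sum>i<n. \<Sum>j<n. if i = j then (d i)\<^sup>2 * indicator {\<tau> i<..\<tau> (Suc i)} u else 0)"
  proof (intro sum.cong refl)
    fix i j assume "i \<in> {..<n}" "j \<in> {..<n}"
    then show "(d i * indicator {\<tau> i<..\<tau> (Suc i)} u) * (d j * indicator {\<tau> j<..\<tau> (Suc j)} u)
      = (if i = j then (d i)\<^sup>2 * indicator {\<tau> i<..\<tau> (Suc i)} u else 0)"
      using disj[of i j] disj[of j i]
      by (cases i j rule: linorder_cases) (auto simp: power2_eq_square indicator_def)
  qed
  finally show ?thesis by simp
qed

lemma char_increment:
  assumes "0 \<le> s" "s < t"
  shows "(CLINT \<omega>|M. iexp (c * (B t \<omega> - B s \<omega>))) = exp (- (c\<^sup>2 * (t - s) / 2))"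
proof -
  define r where "r = sqrt (t - s)"
  have r: "r > 0" "r\<^sup>2 = t - s" using assms by (auto simp: r_def)
  have D: "distributed M lborel (\<lambda>\<omega>. (B t \<omega> - B s \<omega> - 0) / r) std_normal_density"
    using normal_increments[OF assms]
      normal_standard_normal_convert[OF r(1), of "\<lambda>\<omega>. B t \<omega> - B s \<omega>" 0] by (simp add: r_def)
  then have [measurable]: "(\<lambda>\<omega>. (B t \<omega> - B s \<omega> - 0) / r) \<in> borel_measurable M"
    by (auto simp: distributed_def)
  have "distr M borel (\<lambda>\<omega>. (B t \<omega> - B s \<omega> - 0) / r) = distr M lborel (\<lambda>\<omega>. (B t \<omega> - B s \<omega> - 0) / r)"
    by (rule distr_cong) auto
  also have "\<dots> = std_normal_distribution" using D by (simp add: distributed_def)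
  finally have "char (distr M borel (\<lambda>\<omega>. (B t \<omega> - B s \<omega> - 0) / r)) (c * r) = exp (- (c * r)\<^sup>2 / 2)"
    by (simp add: char_std_normal_distribution)
  moreover have "char (distr M borel (\<lambda>\<omega>. (B t \<omega> - B s \<omega> - 0) / r)) (c * r)
     = (CLINT \<omega>|M. iexp ((c * r) * ((B t \<omega> - B s \<omega> - 0) / r)))"
    unfolding char_def by (rule integral_distr) measurable
  moreover have "(c * r) * ((B t \<omega> - B s \<omega> - 0) / r) = c * (B t \<omega> - B s \<omega>)" for \<omega>
    using r by simp
  ultimately show ?thesis using r by (simp add: power_mult_distrib)
qed

text \<open>The cells carry independent centred normal increments, so the characteristic function
  factorises and the variances add up to the squared L2 norm of the integrand.\<close>

lemma elementary_char:
  assumes "elementary g S"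
  shows "integrable lborel (\<lambda>u. (g u)\<^sup>2)"
    and "(CLINT \<omega>|M. iexp (S \<omega>)) = exp (- ((LINT u|lborel. (g u)\<^sup>2) / 2))"
proof -
  obtain n \<tau> d where \<tau>: "strict_mono_on {..n} \<tau>" "0 \<le> \<tau> 0" and g: "g = step_fun n \<tau> d"
    and S: "S = step_integral B n \<tau> d"
    using elementary_imp_step[OF assms] .
  have mono: "mono_on {..n} \<tau>" by (rule strict_mono_on_imp_mono_on[OF \<tau>(1)])
  have \<tau>i: "0 \<le> \<tau> i" "\<tau> i < \<tau> (Suc i)" if "i < n" for i
    using mono_onD[OF mono, of 0 i] strict_mono_onD[OF \<tau>(1), of i "Suc i"] \<tau>(2) that by auto
  have g2: "(g u)\<^sup>2 = (\<Sum>i<n. (d i)\<^sup>2 * indicator {\<tau> i<..\<tau> (Suc i)} u)" for u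
    unfolding g by (rule step_fun_power2[OF mono])
  show "integrable lborel (\<lambda>u. (g u)\<^sup>2)"
    unfolding g2 using \<tau>i
    by (intro Bochner_Integration.integrable_sum integrable_mult_right integrable_real_indicator) (auto simp: less_imp_le)
  have "(LINT u|lborel. (g u)\<^sup>2) = (\<Sum>i<n. (d i)\<^sup>2 * (\<tau> (Suc i) - \<tau> i))"
    unfolding g2 using \<tau>i
    by (subst Bochner_Integration.integral_sum)
       (auto intro!: integrable_mult_right integrable_real_indicator sum.cong simp: less_imp_le)
  have meas: "B (\<tau> i) \<in> borel_measurable M" "B (\<tau> (Suc i)) \<in> borel_measurable M" if "i < n" for i
    using random_variable \<tau>i[OF that] by (auto intro: order_trans less_imp_le)
  have indep: "indep_vars (\<lambda>_. borel) (\<lambda>i \<omega>. d i * (B (\<tau> (Suc i)) \<omega> - B (\<tau> i) \<omega>)) {..<n}"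
    by (rule indep_vars_compose2[OF independent_increments[OF \<tau>(2,1)]]) auto
  have "(CLINT \<omega>|M. iexp (S \<omega>)) = char (distr M borel (\<lambda>\<omega>. \<Sum>i<n. d i * (B (\<tau> (Suc i)) \<omega> - B (\<tau> i) \<omega>))) 1"
    unfolding char_def S step_integral_def by (subst integral_distr) (auto intro!: borel_measurable_sum borel_measurable_times borel_measurable_diff meas)
  also have "\<dots> = (\<Prod>i<n. char (distr M borel (\<lambda>\<omega>. d i * (B (\<tau> (Suc i)) \<omega> - B (\<tau> i) \<omega>))) 1)"
    by (rule char_distr_sum[OF indep])
  also have "\<dots> = (\<Prod>i<n. complex_of_real (exp (- ((d i)\<^sup>2 * (\<tau> (Suc i) - \<tau> i) / 2))))"
  proof (intro prod.cong refl)
    fix i assume "i \<in> {..<n}"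
    then have i: "i < n" by simp
    note [measurable] = meas[OF i]
    have "char (distr M borel (\<lambda>\<omega>. d i * (B (\<tau> (Suc i)) \<omega> - B (\<tau> i) \<omega>))) 1 = (CLINT \<omega>|M. iexp (1 * (d i * (B (\<tau> (Suc i)) \<omega> - B (\<tau> i) \<omega>))))"
      unfolding char_def by (rule integral_distr) measurable
    then show "char (distr M borel (\<lambda>\<omega>. d i * (B (\<tau> (Suc i)) \<omega> - B (\<tau> i) \<omega>))) 1
      = complex_of_real (exp (- ((d i)\<^sup>2 * (\<tau> (Suc i) - \<tau> i) / 2)))"
      using char_increment[OF \<tau>i[OF i], of "d i"] by simp
  qed
  also have "\<dots> = exp (- ((LINT u|lborel. (g u)\<^sup>2) / 2))"
    unfolding \<open>(LINT u|lborel. (g u)\<^sup>2) = _\<close> sum_divide_distrib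
    by (simp add: exp_sum[symmetric] sum_negf[symmetric] flip: of_real_prod)
  finally show "(CLINT \<omega>|M. iexp (S \<omega>)) = exp (- ((LINT u|lborel. (g u)\<^sup>2) / 2))" .
qed

end

section \<open>Closure in mean square and in probability\<close>

context standard_wiener_process
begin

text \<open>The truncated square metrizes convergence in probability. It makes the closure below stable under
  almost sure limits without any integrability argument on the probability space.\<close>
definition wnorm :: "(real \<Rightarrow> real) \<Rightarrow> ('w \<Rightarrow> real) \<Rightarrow> ennreal" where
  "wnorm f X = (\<integral>\<^sup>+u. ennreal ((f u)\<^sup>2) \<partial>lborel) + (\<integral>\<^sup>+\<omega>. ennreal (min 1 ((X \<omega>)\<^sup>2)) \<partial>M)"

text \<open>The closure of the elementary pairs, with integrand and random variable approximated
  simultaneously: \<open>X\<close> is a version of the Wiener integral of \<open>f\<close>.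
  Integrands live on the whole line; the range of integration is encoded by an indicator, so that
  integrals over different ranges can be added.\<close>

definition wiener_pair :: "(real \<Rightarrow> real) \<Rightarrow> ('w \<Rightarrow> real) \<Rightarrow> bool" where
  "wiener_pair f X \<longleftrightarrow> f \<in> borel_measurable lborel \<and> X \<in> borel_measurable M \<and>
     (\<forall>\<epsilon>>0. \<exists>g S. elementary g S \<and> wnorm (\<lambda>u. f u - g u) (\<lambda>\<omega>. X \<omega> - S \<omega>) < \<epsilon>)"

lemma wnorm_zero [simp]: "wnorm (\<lambda>_. 0) (\<lambda>_. 0) = 0"
  by (simp add: wnorm_def)

lemma wnorm_add_le:
  assumes [measurable]: "f \<in> borel_measurable lborel" "g \<in> borel_measurable lborel"
    "X \<in> borel_measurable M" "Y \<in> borel_measurable M"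
  shows "wnorm (\<lambda>u. f u + g u) (\<lambda>\<omega>. X \<omega> + Y \<omega>) \<le> 2 * wnorm f X + 2 * wnorm g Y"
proof -
  have "(\<integral>\<^sup>+u. ennreal ((f u + g u)\<^sup>2) \<partial>lborel) \<le> (\<integral>\<^sup>+u. ennreal (2 * (f u)\<^sup>2 + 2 * (g u)\<^sup>2) \<partial>lborel)"
    by (intro nn_integral_mono ennreal_leI power2_sum_le)
  also have "\<dots> = 2 * (\<integral>\<^sup>+u. ennreal ((f u)\<^sup>2) \<partial>lborel) + 2 * (\<integral>\<^sup>+u. ennreal ((g u)\<^sup>2) \<partial>lborel)"
    by (simp add: ennreal_plus ennreal_mult nn_integral_add nn_integral_cmult)
  finally have 1: "(\<integral>\<^sup>+u. ennreal ((f u + g u)\<^sup>2) \<partial>lborel)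
    \<le> 2 * (\<integral>\<^sup>+u. ennreal ((f u)\<^sup>2) \<partial>lborel) + 2 * (\<integral>\<^sup>+u. ennreal ((g u)\<^sup>2) \<partial>lborel)" .
  have "(\<integral>\<^sup>+\<omega>. ennreal (min 1 ((X \<omega> + Y \<omega>)\<^sup>2)) \<partial>M)
     \<le> (\<integral>\<^sup>+\<omega>. ennreal (2 * min 1 ((X \<omega>)\<^sup>2) + 2 * min 1 ((Y \<omega>)\<^sup>2)) \<partial>M)"
    by (intro nn_integral_mono ennreal_leI min_1_power2_sum_le)
  also have "\<dots> = (\<integral>\<^sup>+\<omega>. 2 * ennreal (min 1 ((X \<omega>)\<^sup>2)) + 2 * ennreal (min 1 ((Y \<omega>)\<^sup>2)) \<partial>M)"
    by (intro nn_integral_cong) (simp add: ennreal_plus ennreal_mult)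
  also have "\<dots> = 2 * (\<integral>\<^sup>+\<omega>. ennreal (min 1 ((X \<omega>)\<^sup>2)) \<partial>M) + 2 * (\<integral>\<^sup>+\<omega>. ennreal (min 1 ((Y \<omega>)\<^sup>2)) \<partial>M)"
    by (subst nn_integral_add) (simp_all add: nn_integral_cmult)
  finally show ?thesis
    using 1 unfolding wnorm_def distrib_left by (metis (no_types, lifting) add.assoc add.left_commute add_mono)
qed

lemma wnorm_scale_le:
  assumes [measurable]: "f \<in> borel_measurable lborel" "X \<in> borel_measurable M"
  shows "wnorm (\<lambda>u. c * f u) (\<lambda>\<omega>. c * X \<omega>) \<le> ennreal (max 1 (c\<^sup>2)) * wnorm f X"
proof -
  have "(\<integral>\<^sup>+u. ennreal ((c * f u)\<^sup>2) \<partial>lborel) \<le> (\<integral>\<^sup>+u. ennreal (max 1 (c\<^sup>2) * (f u)\<^sup>2) \<partial>lborel)"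
    unfolding power_mult_distrib by (intro nn_integral_mono ennreal_leI mult_right_mono) auto
  also have "\<dots> = (\<integral>\<^sup>+u. ennreal (max 1 (c\<^sup>2)) * ennreal ((f u)\<^sup>2) \<partial>lborel)"
    by (intro nn_integral_cong) (simp add: ennreal_mult)
  also have "\<dots> = ennreal (max 1 (c\<^sup>2)) * (\<integral>\<^sup>+u. ennreal ((f u)\<^sup>2) \<partial>lborel)"
    by (rule nn_integral_cmult) measurable
  finally have 1: "(\<integral>\<^sup>+u. ennreal ((c * f u)\<^sup>2) \<partial>lborel)
    \<le> ennreal (max 1 (c\<^sup>2)) * (\<integral>\<^sup>+u. ennreal ((f u)\<^sup>2) \<partial>lborel)" .
  have "(\<integral>\<^sup>+\<omega>. ennreal (min 1 ((c * X \<omega>)\<^sup>2)) \<partial>M) \<le> (\<integral>\<^sup>+\<omega>. ennreal (max 1 (c\<^sup>2) * min 1 ((X \<omega>)\<^sup>2)) \<partial>M)"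
    by (intro nn_integral_mono ennreal_leI min_1_power2_mult_le)
  also have "\<dots> = (\<integral>\<^sup>+\<omega>. ennreal (max 1 (c\<^sup>2)) * ennreal (min 1 ((X \<omega>)\<^sup>2)) \<partial>M)"
    by (intro nn_integral_cong) (simp add: ennreal_mult)
  also have "\<dots> = ennreal (max 1 (c\<^sup>2)) * (\<integral>\<^sup>+\<omega>. ennreal (min 1 ((X \<omega>)\<^sup>2)) \<partial>M)"
    by (rule nn_integral_cmult) measurable
  finally show ?thesis
    using 1 unfolding wnorm_def distrib_left by (rule add_mono[rotated])
qed

lemma wiener_pair_measurable:
  assumes "wiener_pair f X"
  shows "f \<in> borel_measurable lborel" "X \<in> borel_measurable M"
  using assms by (auto simp: wiener_pair_def)

lemma elementary_wiener_pair:
  assumes "elementary g S"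
  shows "wiener_pair g S"
  unfolding wiener_pair_def
  using elementary_measurable[OF assms] assms by (auto intro!: exI[of _ g] exI[of _ S])

text \<open>The closure is closed: a diagonal argument. The quasi-triangle inequality
  \<open>wnorm_add_le\<close> doubles each of two distances, hence the tolerance
  \<open>\<epsilon> / 4\<close>.\<close>

lemma wiener_pair_closed:
  assumes [measurable]: "f \<in> borel_measurable lborel" "X \<in> borel_measurable M"
    and approx: "\<And>\<epsilon>. 0 < \<epsilon> \<Longrightarrow> \<exists>g Y. wiener_pair g Y \<and> wnorm (\<lambda>u. f u - g u) (\<lambda>\<omega>. X \<omega> - Y \<omega>) < \<epsilon>"
  shows "wiener_pair f X"
  unfolding wiener_pair_def
proof (intro conjI allI impI assms)
  fix \<epsilon> :: ennreal assume "0 < \<epsilon>"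
  then have \<epsilon>: "0 < \<epsilon> / 4" by (simp add: ennreal_zero_less_divide)
  obtain g Y where g: "wiener_pair g Y" "wnorm (\<lambda>u. f u - g u) (\<lambda>\<omega>. X \<omega> - Y \<omega>) < \<epsilon> / 4"
    using approx[OF \<epsilon>] by auto
  obtain h S where h: "elementary h S" "wnorm (\<lambda>u. g u - h u) (\<lambda>\<omega>. Y \<omega> - S \<omega>) < \<epsilon> / 4"
    using g(1) \<epsilon> unfolding wiener_pair_def by blast
  note [measurable] = wiener_pair_measurable[OF g(1)] elementary_measurable[OF h(1)]
  have "wnorm (\<lambda>u. f u - h u) (\<lambda>\<omega>. X \<omega> - S \<omega>)
    = wnorm (\<lambda>u. (f u - g u) + (g u - h u)) (\<lambda>\<omega>. (X \<omega> - Y \<omega>) + (Y \<omega> - S \<omega>))" by simp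
  also have "\<dots> \<le> 2 * wnorm (\<lambda>u. f u - g u) (\<lambda>\<omega>. X \<omega> - Y \<omega>) + 2 * wnorm (\<lambda>u. g u - h u) (\<lambda>\<omega>. Y \<omega> - S \<omega>)"
    by (rule wnorm_add_le) measurable
  also have "\<dots> < 2 * (\<epsilon> / 4) + 2 * (\<epsilon> / 4)"
    using g(2) h(2) by (intro add_strict_mono ennreal_mult_strict_left_mono) auto
  also have "\<dots> = \<epsilon>"
  proof -
    have "2 * (\<epsilon> / 4) + 2 * (\<epsilon> / 4) = 4 * (\<epsilon> / 4)" by (simp flip: distrib_right)
    also have "\<dots> = \<epsilon>" by (simp add: ennreal_times_divide mult_divide_eq_ennreal mult.commute)
    finally show ?thesis .
  qed
  finally show "\<exists>g S. elementary g S \<and> wnorm (\<lambda>u. f u - g u) (\<lambda>\<omega>. X \<omega> - S \<omega>) < \<epsilon>"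
    using h(1) by blast
qed

lemma wiener_pair_cong_AE:
  assumes "wiener_pair f X" and [measurable]: "g \<in> borel_measurable lborel" "Y \<in> borel_measurable M"
    and "AE u in lborel. f u = g u" "AE \<omega> in M. X \<omega> = Y \<omega>"
  shows "wiener_pair g Y"
proof (rule wiener_pair_closed)
  fix \<epsilon> :: ennreal assume "0 < \<epsilon>"
  have "(\<integral>\<^sup>+u. ennreal ((g u - f u)\<^sup>2) \<partial>lborel) = (\<integral>\<^sup>+u. 0 \<partial>(lborel :: real measure))"
    by (rule nn_integral_cong_AE) (use assms(4) in auto)
  moreover have "(\<integral>\<^sup>+\<omega>. ennreal (min 1 ((Y \<omega> - X \<omega>)\<^sup>2)) \<partial>M) = (\<integral>\<^sup>+\<omega>. 0 \<partial>M)"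
    by (rule nn_integral_cong_AE) (use assms(5) in auto)
  ultimately show "\<exists>f X. wiener_pair f X \<and> wnorm (\<lambda>u. g u - f u) (\<lambda>\<omega>. Y \<omega> - X \<omega>) < \<epsilon>"
    using assms(1) \<open>0 < \<epsilon>\<close> by (intro exI[of _ f] exI[of _ X]) (simp add: wnorm_def)
qed measurable

lemma wiener_pair_zero: "wiener_pair (\<lambda>_. 0) (\<lambda>_. 0)"
  by (intro elementary_wiener_pair elementary_zero)

lemma wiener_pair_scale:
  assumes "wiener_pair f X"
  shows "wiener_pair (\<lambda>u. c * f u) (\<lambda>\<omega>. c * X \<omega>)"
proof (rule wiener_pair_closed)
  note [measurable] = wiener_pair_measurable[OF assms]
  show "(\<lambda>u. c * f u) \<in> borel_measurable lborel" "(\<lambda>\<omega>. c * X \<omega>) \<in> borel_measurable M" by measurable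
  fix \<epsilon> :: ennreal assume "0 < \<epsilon>"
  \<comment> \<open>The truncation level 1 does not scale with \<open>c\<close>, so the factor must
    be at least 1; this also permits division by \<open>C\<close> when \<open>c = 0\<close>.\<close>
  define C where "C = ennreal (max 1 (c\<^sup>2))"
  have C: "0 < C" "C \<noteq> \<top>" by (auto simp: C_def less_max_iff_disj)
  then have \<epsilon>: "0 < \<epsilon> / C" using \<open>0 < \<epsilon>\<close> by (simp add: ennreal_zero_less_divide top.not_eq_extremum)
  obtain g S where g: "elementary g S" "wnorm (\<lambda>u. f u - g u) (\<lambda>\<omega>. X \<omega> - S \<omega>) < \<epsilon> / C"
    using assms \<epsilon> unfolding wiener_pair_def by blast
  note [measurable] = elementary_measurable[OF g(1)]
  have "wnorm (\<lambda>u. c * f u - c * g u) (\<lambda>\<omega>. c * X \<omega> - c * S \<omega>) \<le> C * wnorm (\<lambda>u. f u - g u) (\<lambda>\<omega>. X \<omega> - S \<omega>)"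
    using wnorm_scale_le[of "\<lambda>u. f u - g u" "\<lambda>\<omega>. X \<omega> - S \<omega>" c] by (simp add: C_def right_diff_distrib)
  also have "\<dots> < C * (\<epsilon> / C)"
    using g(2) C by (intro ennreal_mult_strict_left_mono) (auto simp: top.not_eq_extremum)
  also have "\<dots> = \<epsilon>"
    using C by (simp only: ennreal_times_divide mult.commute[of C]) (simp add: mult_divide_eq_ennreal)
  finally show "\<exists>g Y. wiener_pair g Y \<and> wnorm (\<lambda>u. c * f u - g u) (\<lambda>\<omega>. c * X \<omega> - Y \<omega>) < \<epsilon>"
    using elementary_wiener_pair[OF elementary_scale[OF g(1), of c]] by (intro exI conjI)
qed

lemma wiener_pair_add:
  assumes "wiener_pair f X" "wiener_pair g Y"
  shows "wiener_pair (\<lambda>u. f u + g u) (\<lambda>\<omega>. X \<omega> + Y \<omega>)"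
proof (rule wiener_pair_closed)
  note [measurable] = wiener_pair_measurable[OF assms(1)] wiener_pair_measurable[OF assms(2)]
  show "(\<lambda>u. f u + g u) \<in> borel_measurable lborel" "(\<lambda>\<omega>. X \<omega> + Y \<omega>) \<in> borel_measurable M" by measurable
  fix \<epsilon> :: ennreal assume "0 < \<epsilon>"
  then have \<epsilon>: "0 < \<epsilon> / 4" by (simp add: ennreal_zero_less_divide)
  obtain h S where h: "elementary h S" "wnorm (\<lambda>u. f u - h u) (\<lambda>\<omega>. X \<omega> - S \<omega>) < \<epsilon> / 4"
    using assms(1) \<epsilon> unfolding wiener_pair_def by blast
  obtain k R where k: "elementary k R" "wnorm (\<lambda>u. g u - k u) (\<lambda>\<omega>. Y \<omega> - R \<omega>) < \<epsilon> / 4"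
    using assms(2) \<epsilon> unfolding wiener_pair_def by blast
  note [measurable] = elementary_measurable[OF h(1)] elementary_measurable[OF k(1)]
  have "wnorm (\<lambda>u. f u + g u - (h u + k u)) (\<lambda>\<omega>. X \<omega> + Y \<omega> - (S \<omega> + R \<omega>))
    = wnorm (\<lambda>u. (f u - h u) + (g u - k u)) (\<lambda>\<omega>. (X \<omega> - S \<omega>) + (Y \<omega> - R \<omega>))" by (simp add: add_diff_add)
  also have "\<dots> \<le> 2 * wnorm (\<lambda>u. f u - h u) (\<lambda>\<omega>. X \<omega> - S \<omega>) + 2 * wnorm (\<lambda>u. g u - k u) (\<lambda>\<omega>. Y \<omega> - R \<omega>)"
    by (rule wnorm_add_le) measurable
  also have "\<dots> < 2 * (\<epsilon> / 4) + 2 * (\<epsilon> / 4)"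
    using h(2) k(2) by (intro add_strict_mono ennreal_mult_strict_left_mono) auto
  also have "\<dots> = \<epsilon>"
  proof -
    have "2 * (\<epsilon> / 4) + 2 * (\<epsilon> / 4) = 4 * (\<epsilon> / 4)" by (simp flip: distrib_right)
    also have "\<dots> = \<epsilon>" by (simp add: ennreal_times_divide mult_divide_eq_ennreal mult.commute)
    finally show ?thesis .
  qed
  finally show "\<exists>h Z. wiener_pair h Z \<and> wnorm (\<lambda>u. f u + g u - h u) (\<lambda>\<omega>. X \<omega> + Y \<omega> - Z \<omega>) < \<epsilon>"
    using elementary_wiener_pair[OF elementary_add[OF h(1) k(1)]] by (intro exI conjI)
qed

lemma wiener_pair_diff:
  assumes "wiener_pair f X" "wiener_pair g Y"
  shows "wiener_pair (\<lambda>u. f u - g u) (\<lambda>\<omega>. X \<omega> - Y \<omega>)"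
  using wiener_pair_add[OF assms(1) wiener_pair_scale[OF assms(2), of "-1"]] by simp

lemma wiener_pair_sum:
  assumes "\<And>i. i \<in> A \<Longrightarrow> wiener_pair (f i) (X i)"
  shows "wiener_pair (\<lambda>u. \<Sum>i\<in>A. f i u) (\<lambda>\<omega>. \<Sum>i\<in>A. X i \<omega>)"
  using assms
  by (induction A rule: infinite_finite_induct) (auto intro: wiener_pair_zero wiener_pair_add)

text \<open>The truncated square lies below the square, so approximation in L2 implies approximation
  in \<open>wnorm\<close>.\<close>

lemma has_wiener_integral_wiener_pair:
  assumes I: "has_wiener_integral M B f t I" and f: "(\<lambda>u. indicator {0..t} u * f u) \<in> borel_measurable lborel"
  shows "wiener_pair (\<lambda>u. indicator {0..t} u * f u) I"
proof (rule wiener_pair_closed)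
  show "(\<lambda>u. indicator {0..t} u * f u) \<in> borel_measurable lborel" by (rule f)
  show "I \<in> borel_measurable M" using I by (auto simp: has_wiener_integral_def)
  obtain n \<tau> c where \<tau>: "\<And>k. mono_on {..n k} (\<tau> k)" "\<And>k. 0 \<le> \<tau> k 0" "\<And>k. \<tau> k (n k) \<le> t"
    and l1: "(\<lambda>k. \<integral>\<^sup>+u\<in>{0..t}. ennreal ((f u - step_fun (n k) (\<tau> k) (c k) u)\<^sup>2) \<partial>lborel) \<longlonglongrightarrow> 0"
    and l2: "(\<lambda>k. \<integral>\<^sup>+\<omega>. ennreal ((I \<omega> - step_integral B (n k) (\<tau> k) (c k) \<omega>)\<^sup>2) \<partial>M) \<longlonglongrightarrow> 0"
    using I unfolding has_wiener_integral_def by auto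
  fix \<epsilon> :: ennreal assume "0 < \<epsilon>"
  have "(\<lambda>k. (\<integral>\<^sup>+u\<in>{0..t}. ennreal ((f u - step_fun (n k) (\<tau> k) (c k) u)\<^sup>2) \<partial>lborel)
     + (\<integral>\<^sup>+\<omega>. ennreal ((I \<omega> - step_integral B (n k) (\<tau> k) (c k) \<omega>)\<^sup>2) \<partial>M)) \<longlonglongrightarrow> 0 + 0"
    by (intro tendsto_add l1 l2)
  then have "eventually (\<lambda>k. (\<integral>\<^sup>+u\<in>{0..t}. ennreal ((f u - step_fun (n k) (\<tau> k) (c k) u)\<^sup>2) \<partial>lborel)
     + (\<integral>\<^sup>+\<omega>. ennreal ((I \<omega> - step_integral B (n k) (\<tau> k) (c k) \<omega>)\<^sup>2) \<partial>M) < \<epsilon>) sequentially"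
    using \<open>0 < \<epsilon>\<close> by (intro order_tendstoD(2)) auto
  then obtain k where k: "(\<integral>\<^sup>+u\<in>{0..t}. ennreal ((f u - step_fun (n k) (\<tau> k) (c k) u)\<^sup>2) \<partial>lborel)
     + (\<integral>\<^sup>+\<omega>. ennreal ((I \<omega> - step_integral B (n k) (\<tau> k) (c k) \<omega>)\<^sup>2) \<partial>M) < \<epsilon>"
    by (auto simp: eventually_sequentially)
  \<comment> \<open>All cells lie inside the interval from 0 to \<open>t\<close>, so cutting
    \<open>f\<close> off outside creates no additional error on the whole line.\<close>
  have zero: "step_fun (n k) (\<tau> k) (c k) u = 0" if "u \<notin> {0..t}" for u
    unfolding step_fun_def
  proof (intro sum.neutral ballI)
    fix i assume "i \<in> {..<n k}"
    then have "0 \<le> \<tau> k i" "\<tau> k (Suc i) \<le> t"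
      using mono_onD[OF \<tau>(1)[of k], of 0 i] mono_onD[OF \<tau>(1)[of k], of "Suc i" "n k"] \<tau>(2,3)[of k] by auto
    then show "c k i * indicator {\<tau> k i<..\<tau> k (Suc i)} u = 0"
      using that by (auto simp: indicator_def)
  qed
  have "wnorm (\<lambda>u. indicator {0..t} u * f u - step_fun (n k) (\<tau> k) (c k) u)
      (\<lambda>\<omega>. I \<omega> - step_integral B (n k) (\<tau> k) (c k) \<omega>)
    \<le> (\<integral>\<^sup>+u\<in>{0..t}. ennreal ((f u - step_fun (n k) (\<tau> k) (c k) u)\<^sup>2) \<partial>lborel)
     + (\<integral>\<^sup>+\<omega>. ennreal ((I \<omega> - step_integral B (n k) (\<tau> k) (c k) \<omega>)\<^sup>2) \<partial>M)"
    unfolding wnorm_def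
    by (intro add_mono nn_integral_mono) (auto simp: indicator_def zero intro!: ennreal_leI)
  also note k
  finally show "\<exists>g Y. wiener_pair g Y \<and> wnorm (\<lambda>u. indicator {0..t} u * f u - g u) (\<lambda>\<omega>. I \<omega> - Y \<omega>) < \<epsilon>"
    using elementary_wiener_pair[OF elementary_step[OF \<tau>(1,2)]] by (intro exI conjI)
qed

lemma wiener_pair_approx:
  assumes "wiener_pair f X" "0 < \<epsilon>"
  obtains g S where "elementary g S" "integrable lborel (\<lambda>u. (f u - g u)\<^sup>2)"
    "(LINT u|lborel. (f u - g u)\<^sup>2) < \<epsilon>" "(LINT \<omega>|M. min 1 ((X \<omega> - S \<omega>)\<^sup>2)) < \<epsilon>"
proof -
  obtain g S where g: "elementary g S" "wnorm (\<lambda>u. f u - g u) (\<lambda>\<omega>. X \<omega> - S \<omega>) < ennreal \<epsilon>"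
    using assms unfolding wiener_pair_def by (meson ennreal_less_zero_iff)
  note [measurable] = wiener_pair_measurable[OF assms(1)] elementary_measurable[OF g(1)]
  have 1: "(\<integral>\<^sup>+u. ennreal ((f u - g u)\<^sup>2) \<partial>lborel) < ennreal \<epsilon>"
    using g(2) unfolding wnorm_def by (rule le_less_trans[rotated]) simp
  have 2: "(\<integral>\<^sup>+\<omega>. ennreal (min 1 ((X \<omega> - S \<omega>)\<^sup>2)) \<partial>M) < ennreal \<epsilon>"
    using g(2) unfolding wnorm_def by (rule le_less_trans[rotated]) simp
  have "integrable lborel (\<lambda>u. (f u - g u)\<^sup>2)"
    by (rule integrableI_nonneg) (use 1 in \<open>auto intro: less_trans\<close>)
  moreover have "(LINT u|lborel. (f u - g u)\<^sup>2) < \<epsilon>"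
    using 1 assms(2) nn_integral_eq_integral[OF calculation] by (simp add: ennreal_less_iff)
  moreover have "integrable M (\<lambda>\<omega>. min 1 ((X \<omega> - S \<omega>)\<^sup>2))"
    by (rule integrable_const_bound[where B=1]) auto
  then have "(LINT \<omega>|M. min 1 ((X \<omega> - S \<omega>)\<^sup>2)) < \<epsilon>"
    using 2 assms(2) by (subst (asm) nn_integral_eq_integral) (auto simp: ennreal_less_iff)
  ultimately show ?thesis using g(1) that by blast
qed

lemma wiener_pair_integrable:
  assumes "wiener_pair f X"
  shows "integrable lborel (\<lambda>u. (f u)\<^sup>2)"
proof -
  obtain g S where g: "elementary g S" "integrable lborel (\<lambda>u. (f u - g u)\<^sup>2)"
    by (rule wiener_pair_approx[OF assms zero_less_one])
  note [measurable] = wiener_pair_measurable[OF assms]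
  have "integrable lborel (\<lambda>u. 2 * (f u - g u)\<^sup>2 + 2 * (g u)\<^sup>2)"
    using g(2) elementary_char(1)[OF g(1)] by (intro Bochner_Integration.integrable_add integrable_mult_right)
  then show ?thesis
  proof (rule Bochner_Integration.integrable_bound)
    have "(f u)\<^sup>2 \<le> 2 * (f u - g u)\<^sup>2 + 2 * (g u)\<^sup>2" for u
      using power2_sum_le[of "f u - g u" "g u"] by simp
    then show "AE u in lborel. norm ((f u)\<^sup>2) \<le> norm (2 * (f u - g u)\<^sup>2 + 2 * (g u)\<^sup>2)"
      by simp
  qed measurable
qed

text \<open>Both sides pass to the limit along elementary approximations: the squared L2 norm by
  mean square convergence of the integrands, the characteristic function by convergence in
  probability.\<close>

theorem wiener_pair_char:
  assumes fX: "wiener_pair f X"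
  shows "(CLINT \<omega>|M. iexp (X \<omega>)) = exp (- ((LINT u|lborel. (f u)\<^sup>2) / 2))"
proof -
  note [measurable] = wiener_pair_measurable[OF fX]
  define \<delta> :: "nat \<Rightarrow> real" where "\<delta> k = 1 / real (Suc k)" for k
  have \<delta>: "0 < \<delta> k" "\<delta> k \<le> 1" for k by (auto simp: \<delta>_def)
  have \<delta>0: "\<delta> \<longlonglongrightarrow> 0" unfolding \<delta>_def by (rule LIMSEQ_Suc[OF lim_1_over_n])
  \<comment> \<open>The tolerance is the square of \<open>\<delta> k\<close> because each of the two
    error bounds below divides by \<open>\<delta> k\<close> once.\<close>
  have "\<forall>k. \<exists>g S. elementary g S \<and> integrable lborel (\<lambda>u. (f u - g u)\<^sup>2) \<and>
    (LINT u|lborel. (f u - g u)\<^sup>2) < (\<delta> k)\<^sup>2 \<and> (LINT \<omega>|M. min 1 ((X \<omega> - S \<omega>)\<^sup>2)) < (\<delta> k)\<^sup>2"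
  proof
    fix k
    have "0 < (\<delta> k)\<^sup>2" using \<delta>(1)[of k] by simp
    from wiener_pair_approx[OF fX this] show "\<exists>g S. elementary g S \<and> integrable lborel (\<lambda>u. (f u - g u)\<^sup>2) \<and>
      (LINT u|lborel. (f u - g u)\<^sup>2) < (\<delta> k)\<^sup>2 \<and> (LINT \<omega>|M. min 1 ((X \<omega> - S \<omega>)\<^sup>2)) < (\<delta> k)\<^sup>2"
      by blast
  qed
  then obtain g S where g: "\<And>k. elementary (g k) (S k)" "\<And>k. integrable lborel (\<lambda>u. (f u - g k u)\<^sup>2)"
    "\<And>k. (LINT u|lborel. (f u - g k u)\<^sup>2) < (\<delta> k)\<^sup>2" "\<And>k. (LINT \<omega>|M. min 1 ((X \<omega> - S k \<omega>)\<^sup>2)) < (\<delta> k)\<^sup>2"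
    unfolding choice_iff by blast
  have [measurable]: "S k \<in> borel_measurable M" for k using elementary_measurable[OF g(1)] by simp
  define a where "a = (LINT u|lborel. (f u)\<^sup>2)"
  define b where "b k = (LINT u|lborel. (g k u)\<^sup>2)" for k
  note int = wiener_pair_integrable[OF fX] elementary_char(1)[OF g(1)] g(2)
  have bd: "\<bar>a - b k\<bar> \<le> \<delta> k * a + ((\<delta> k)\<^sup>2 + \<delta> k)" for k
  proof -
    \<comment> \<open>Young's inequality for the cross term, \<open>2 * \<bar>f u * h\<bar> \<le>
      \<delta> k * (f u)\<^sup>2 + h\<^sup>2 / \<delta> k\<close>, takes the place of the
      Cauchy-Schwarz inequality for integrals.\<close>
    have pw: "\<bar>(f u)\<^sup>2 - (g k u)\<^sup>2\<bar> \<le> \<delta> k * (f u)\<^sup>2 + (1 + 1 / \<delta> k) * (f u - g k u)\<^sup>2" for u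
    proof -
      define h where "h = f u - g k u"
      have "0 \<le> (\<delta> k * \<bar>f u\<bar> - \<bar>h\<bar>)\<^sup>2 / \<delta> k" using \<delta>(1)[of k] by simp
      also have "\<dots> = \<delta> k * (f u)\<^sup>2 - 2 * \<bar>f u\<bar> * \<bar>h\<bar> + h\<^sup>2 / \<delta> k"
        using \<delta>(1)[of k] by (simp add: power2_diff field_simps power2_eq_square)
      finally have "2 * \<bar>f u * h\<bar> \<le> \<delta> k * (f u)\<^sup>2 + h\<^sup>2 / \<delta> k" by (simp add: abs_mult)
      moreover have "(f u)\<^sup>2 - (g k u)\<^sup>2 = 2 * (f u * h) - h\<^sup>2"
        by (simp add: h_def power2_eq_square algebra_simps)
      ultimately show ?thesis
        unfolding h_def[symmetric] by (simp add: distrib_right abs_le_iff) (smt (verit) zero_le_power2)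
    qed
    have "\<bar>a - b k\<bar> = \<bar>LINT u|lborel. (f u)\<^sup>2 - (g k u)\<^sup>2\<bar>"
      unfolding a_def b_def using int by simp
    also have "\<dots> \<le> (LINT u|lborel. \<bar>(f u)\<^sup>2 - (g k u)\<^sup>2\<bar>)"
      by (rule integral_abs_bound)
    also have "\<dots> \<le> (LINT u|lborel. \<delta> k * (f u)\<^sup>2 + (1 + 1 / \<delta> k) * (f u - g k u)\<^sup>2)"
      using int pw by (intro integral_mono) auto
    also have "\<dots> = \<delta> k * a + (1 + 1 / \<delta> k) * (LINT u|lborel. (f u - g k u)\<^sup>2)"
      unfolding a_def using int by simp
    also have "\<dots> \<le> \<delta> k * a + (1 + 1 / \<delta> k) * (\<delta> k)\<^sup>2"
      using g(3)[of k] \<delta>(1)[of k] by (intro add_left_mono mult_left_mono) auto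
    also have "(1 + 1 / \<delta> k) * (\<delta> k)\<^sup>2 = (\<delta> k)\<^sup>2 + \<delta> k"
      using \<delta>(1)[of k] by (simp add: field_simps power2_eq_square)
    finally show ?thesis .
  qed
  have "(\<lambda>k. \<delta> k * a + ((\<delta> k)\<^sup>2 + \<delta> k)) \<longlonglongrightarrow> 0 * a + (0\<^sup>2 + 0)"
    by (intro tendsto_intros \<delta>0)
  then have lim: "(\<lambda>k. \<delta> k * a + ((\<delta> k)\<^sup>2 + \<delta> k)) \<longlonglongrightarrow> 0" by simp
  have "(\<lambda>k. a - b k) \<longlonglongrightarrow> 0"
    by (rule Lim_null_comparison[OF _ lim]) (simp only: real_norm_def bd eventually_True)
  then have "b \<longlonglongrightarrow> a"
    using tendsto_diff[OF tendsto_const[of a], of "\<lambda>k. a - b k" 0] by simp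
  then have "(\<lambda>k. exp (- (b k / 2))) \<longlonglongrightarrow> exp (- (a / 2))"
    by (intro tendsto_intros) auto
  then have 1: "(\<lambda>k. CLINT \<omega>|M. iexp (S k \<omega>)) \<longlonglongrightarrow> complex_of_real (exp (- (a / 2)))"
    unfolding elementary_char(2)[OF g(1)] b_def by (intro tendsto_of_real)
  have bd': "cmod ((CLINT \<omega>|M. iexp (X \<omega>)) - (CLINT \<omega>|M. iexp (S k \<omega>))) \<le> 4 * \<delta> k" for k
  proof -
    have i: "integrable M (\<lambda>\<omega>. iexp (X \<omega>))" "integrable M (\<lambda>\<omega>. iexp (S k \<omega>))"
      by (rule integrable_const_bound[where B=1]; simp)+
    have i2: "integrable M (\<lambda>\<omega>. min 1 ((X \<omega> - S k \<omega>)\<^sup>2))"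
      by (rule integrable_const_bound[where B=1]) auto
    have "cmod ((CLINT \<omega>|M. iexp (X \<omega>)) - (CLINT \<omega>|M. iexp (S k \<omega>)))
      = cmod (CLINT \<omega>|M. iexp (X \<omega>) - iexp (S k \<omega>))" using i by simp
    also have "\<dots> \<le> (LINT \<omega>|M. cmod (iexp (X \<omega>) - iexp (S k \<omega>)))"
      by (rule integral_norm_bound)
    also have "\<dots> \<le> (LINT \<omega>|M. 2 * \<delta> k + 2 / \<delta> k * min 1 ((X \<omega> - S k \<omega>)\<^sup>2))"
      using i i2 cmod_iexp_diff_le[OF \<delta>] by (intro integral_mono) auto
    also have "\<dots> = 2 * \<delta> k + 2 / \<delta> k * (LINT \<omega>|M. min 1 ((X \<omega> - S k \<omega>)\<^sup>2))"
      using i2 by (simp add: prob_space)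
    also have "\<dots> \<le> 2 * \<delta> k + 2 / \<delta> k * (\<delta> k)\<^sup>2"
      using g(4)[of k] \<delta>(1)[of k] by (intro add_left_mono mult_left_mono) auto
    also have "\<dots> = 4 * \<delta> k" using \<delta>(1)[of k] by (simp add: field_simps power2_eq_square)
    finally show ?thesis .
  qed
  have "(\<lambda>k. 4 * \<delta> k) \<longlonglongrightarrow> 4 * 0" by (intro tendsto_intros \<delta>0)
  then have lim': "(\<lambda>k. 4 * \<delta> k) \<longlonglongrightarrow> 0" by simp
  have "(\<lambda>k. (CLINT \<omega>|M. iexp (X \<omega>)) - (CLINT \<omega>|M. iexp (S k \<omega>))) \<longlonglongrightarrow> 0"
    by (rule Lim_null_comparison[OF _ lim']) (simp only: bd' eventually_True)
  then have "(\<lambda>k. CLINT \<omega>|M. iexp (S k \<omega>)) \<longlonglongrightarrow> (CLINT \<omega>|M. iexp (X \<omega>))"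
    using tendsto_diff[OF tendsto_const[of "CLINT \<omega>|M. iexp (X \<omega>)"],
      of "\<lambda>k. (CLINT \<omega>|M. iexp (X \<omega>)) - (CLINT \<omega>|M. iexp (S k \<omega>))" 0] by simp
  then show ?thesis
    using LIMSEQ_unique[OF 1] unfolding a_def by simp
qed

end

section \<open>Pathwise integration by parts\<close>

text \<open>\<open>k + 1\<close> equal cells, so that the grid is never empty and
  \<open>k = 0\<close> causes no division by zero.\<close>

definition ugrid :: "real \<Rightarrow> nat \<Rightarrow> nat \<Rightarrow> real" where
  "ugrid t k i = t * real i / real (Suc k)"

lemma ugrid_0 [simp]: "ugrid t k 0 = 0"
  by (simp add: ugrid_def)

lemma ugrid_last [simp]: "ugrid t k (Suc k) = t"
  by (simp add: ugrid_def del: of_nat_Suc)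

lemma ugrid_step: "ugrid t k (Suc i) = ugrid t k i + t / real (Suc k)"
  unfolding ugrid_def of_nat_Suc[of i] add_divide_distrib[symmetric] by (simp add: algebra_simps del: of_nat_Suc)

lemma ugrid_mono: "0 \<le> t \<Longrightarrow> i \<le> j \<Longrightarrow> ugrid t k i \<le> ugrid t k j"
  by (auto simp: ugrid_def intro!: divide_right_mono mult_left_mono)

lemma ugrid_bounds: "0 \<le> t \<Longrightarrow> i \<le> Suc k \<Longrightarrow> ugrid t k i \<in> {0..t}"
  using ugrid_mono[of t 0 i k] ugrid_mono[of t i "Suc k" k] by auto

lemma eventually_ugrid_uniform:
  fixes \<phi> :: "real \<Rightarrow> real"
  assumes \<phi>: "continuous_on {0..t} \<phi>" and t: "0 \<le> t" and \<epsilon>: "0 < \<epsilon>"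
  shows "eventually (\<lambda>k. \<forall>i<Suc k. \<forall>x\<in>{ugrid t k i..ugrid t k (Suc i)}. \<forall>y\<in>{ugrid t k i..ugrid t k (Suc i)}.
    \<bar>\<phi> x - \<phi> y\<bar> < \<epsilon>) sequentially"
proof -
  have "uniformly_continuous_on {0..t} \<phi>"
    by (rule compact_uniformly_continuous[OF \<phi>]) simp
  then obtain \<delta> where \<delta>: "\<delta> > 0" "\<And>x y. y \<in> {0..t} \<Longrightarrow> x \<in> {0..t} \<Longrightarrow> \<bar>x - y\<bar> < \<delta> \<Longrightarrow> \<bar>\<phi> x - \<phi> y\<bar> < \<epsilon>"
    using \<epsilon> unfolding uniformly_continuous_on_def dist_real_def by blast
  have "(\<lambda>k. t / real (Suc k)) \<longlonglongrightarrow> 0"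
    by (rule LIMSEQ_Suc[OF lim_const_over_n])
  then have "eventually (\<lambda>k. t / real (Suc k) < \<delta>) sequentially"
    using \<delta>(1) by (rule order_tendstoD)
  then show ?thesis
  proof eventually_elim
    case (elim k)
    show ?case
    proof (intro allI impI ballI)
      fix i x y
      assume i: "i < Suc k" and xy: "x \<in> {ugrid t k i..ugrid t k (Suc i)}" "y \<in> {ugrid t k i..ugrid t k (Suc i)}"
      have "y \<in> {0..t}" "x \<in> {0..t}"
        using xy ugrid_bounds[OF t, of i k] ugrid_bounds[OF t, of "Suc i" k] i by auto
      moreover have "\<bar>x - y\<bar> < \<delta>" using xy elim unfolding ugrid_step by auto
      ultimately show "\<bar>\<phi> x - \<phi> y\<bar> < \<epsilon>" by (rule \<delta>(2))
    qed
  qed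
qed

lemma integral_ugrid_sum:
  fixes h :: "real \<Rightarrow> real"
  assumes h: "continuous_on {0..t} h" and t: "0 \<le> t"
  shows "integral {0..t} h = (\<Sum>i<Suc k. integral {ugrid t k i..ugrid t k (Suc i)} h)"
proof -
  have "integral {0..ugrid t k m} h = (\<Sum>i<m. integral {ugrid t k i..ugrid t k (Suc i)} h)" if "m \<le> Suc k" for m
    using that
  proof (induction m)
    case (Suc m)
    have "integral {0..ugrid t k m} h + integral {ugrid t k m..ugrid t k (Suc m)} h = integral {0..ugrid t k (Suc m)} h"
    proof (rule Henstock_Kurzweil_Integration.integral_combine)
      show "0 \<le> ugrid t k m" "ugrid t k m \<le> ugrid t k (Suc m)"
        using ugrid_bounds[OF t, of m k] ugrid_mono[OF t, of m "Suc m" k] Suc.prems by auto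
      show "h integrable_on {0..ugrid t k (Suc m)}"
        using ugrid_bounds[OF t, of "Suc m" k] Suc.prems
        by (intro integrable_continuous_interval continuous_on_subset[OF h]) auto
    qed
    then show ?case using Suc by simp
  qed simp
  from this[of "Suc k"] show ?thesis by simp
qed

lemma riemann_tagged_tendsto:
  fixes \<phi> \<psi> :: "real \<Rightarrow> real"
  assumes \<phi>: "continuous_on {0..t} \<phi>" and \<psi>: "continuous_on {0..t} \<psi>" and t: "0 \<le> t"
    and \<xi>: "\<And>k i. i < Suc k \<Longrightarrow> \<xi> k i \<in> {ugrid t k i..ugrid t k (Suc i)}"
  shows "(\<lambda>k. \<Sum>i<Suc k. \<phi> (\<xi> k i) * integral {ugrid t k i..ugrid t k (Suc i)} \<psi>)
    \<longlonglongrightarrow> integral {0..t} (\<lambda>u. \<phi> u * \<psi> u)"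
proof (rule LIMSEQ_I)
  fix \<epsilon> :: real assume \<epsilon>: "0 < \<epsilon>"
  define A where "A = integral {0..t} (\<lambda>u. \<bar>\<psi> u\<bar>)"
  have A: "A \<ge> 0" unfolding A_def by (rule integral_nonneg) (auto intro!: integrable_continuous_interval continuous_intros \<psi>)
  \<comment> \<open>The summand 1 covers the case \<open>A = 0\<close>.\<close>
  define \<eta> where "\<eta> = \<epsilon> / (A + 1)"
  have \<eta>: "\<eta> > 0" "\<eta> * A < \<epsilon>" using A \<epsilon> by (auto simp: \<eta>_def field_simps)
  have "norm ((\<Sum>i<Suc k. \<phi> (\<xi> k i) * integral {ugrid t k i..ugrid t k (Suc i)} \<psi>) - integral {0..t} (\<lambda>u. \<phi> u * \<psi> u)) < \<epsilon>"
    if k: "\<forall>i<Suc k. \<forall>x\<in>{ugrid t k i..ugrid t k (Suc i)}. \<forall>y\<in>{ugrid t k i..ugrid t k (Suc i)}. \<bar>\<phi> x - \<phi> y\<bar> < \<eta>" for k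
  proof -
    have piece: "\<bar>\<phi> (\<xi> k i) * integral {ugrid t k i..ugrid t k (Suc i)} \<psi> - integral {ugrid t k i..ugrid t k (Suc i)} (\<lambda>u. \<phi> u * \<psi> u)\<bar>
        \<le> \<eta> * integral {ugrid t k i..ugrid t k (Suc i)} (\<lambda>u. \<bar>\<psi> u\<bar>)" if i: "i < Suc k" for i
    proof -
      let ?I = "{ugrid t k i..ugrid t k (Suc i)}"
      have sub: "?I \<subseteq> {0..t}" using ugrid_bounds[OF t, of i k] ugrid_bounds[OF t, of "Suc i" k] i by auto
      note c = continuous_on_subset[OF \<phi> sub] continuous_on_subset[OF \<psi> sub]
      have "\<phi> (\<xi> k i) * integral ?I \<psi> - integral ?I (\<lambda>u. \<phi> u * \<psi> u) = integral ?I (\<lambda>u. \<phi> (\<xi> k i) * \<psi> u - \<phi> u * \<psi> u)"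
        by (subst Henstock_Kurzweil_Integration.integral_diff) (auto intro!: integrable_continuous_interval continuous_intros c)
      also have "norm \<dots> \<le> integral ?I (\<lambda>u. \<eta> * \<bar>\<psi> u\<bar>)"
      proof (rule integral_norm_bound_integral)
        fix u assume "u \<in> ?I"
        then have "\<bar>\<phi> (\<xi> k i) - \<phi> u\<bar> \<le> \<eta>" using k i \<xi>[OF i] less_imp_le by blast
        then show "norm (\<phi> (\<xi> k i) * \<psi> u - \<phi> u * \<psi> u) \<le> \<eta> * \<bar>\<psi> u\<bar>"
          by (simp add: abs_mult mult_right_mono flip: left_diff_distrib)
      qed (auto intro!: integrable_continuous_interval continuous_intros c)
      finally show ?thesis by simp
    qed
    have "\<bar>(\<Sum>i<Suc k. \<phi> (\<xi> k i) * integral {ugrid t k i..ugrid t k (Suc i)} \<psi>) - integral {0..t} (\<lambda>u. \<phi> u * \<psi> u)\<bar>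
      = \<bar>\<Sum>i<Suc k. \<phi> (\<xi> k i) * integral {ugrid t k i..ugrid t k (Suc i)} \<psi> - integral {ugrid t k i..ugrid t k (Suc i)} (\<lambda>u. \<phi> u * \<psi> u)\<bar>"
      unfolding sum_subtractf by (subst integral_ugrid_sum[OF _ t, of _ k]) (auto intro!: continuous_intros \<phi> \<psi>)
    also have "\<dots> \<le> (\<Sum>i<Suc k. \<bar>\<phi> (\<xi> k i) * integral {ugrid t k i..ugrid t k (Suc i)} \<psi> - integral {ugrid t k i..ugrid t k (Suc i)} (\<lambda>u. \<phi> u * \<psi> u)\<bar>)"
      by (rule sum_abs)
    also have "\<dots> \<le> (\<Sum>i<Suc k. \<eta> * integral {ugrid t k i..ugrid t k (Suc i)} (\<lambda>u. \<bar>\<psi> u\<bar>))"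
      by (intro sum_mono piece) simp
    also have "\<dots> = \<eta> * A"
      unfolding A_def sum_distrib_left[symmetric] by (subst integral_ugrid_sum[OF _ t, of _ k]) (auto intro!: continuous_intros \<psi>)
    finally show ?thesis using \<eta>(2) by simp
  qed
  with eventually_ugrid_uniform[OF \<phi> t \<eta>(1)]
  have "eventually (\<lambda>k. norm ((\<Sum>i<Suc k. \<phi> (\<xi> k i) * integral {ugrid t k i..ugrid t k (Suc i)} \<psi>)
      - integral {0..t} (\<lambda>u. \<phi> u * \<psi> u)) < \<epsilon>) sequentially"
    by (rule eventually_mono)
  then show "\<exists>N. \<forall>k\<ge>N. norm ((\<Sum>i<Suc k. \<phi> (\<xi> k i) * integral {ugrid t k i..ugrid t k (Suc i)} \<psi>)
      - integral {0..t} (\<lambda>u. \<phi> u * \<psi> u)) < \<epsilon>"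
    unfolding eventually_sequentially .
qed

text \<open>Integration by parts for Riemann-Stieltjes sums of \<open>\<integral> E dw\<close>, where \<open>w\<close> need not have bounded
  variation but \<open>E\<close> has the derivative \<open>e\<close>.\<close>
lemma weighted_increments_tendsto:
  fixes E e z p :: "real \<Rightarrow> real"
  assumes t: "0 \<le> t" and z: "continuous_on {0..t} z" "z 0 = 0" and p: "continuous_on {0..t} p"
    and E: "continuous_on {0..t} E" and e: "continuous_on {0..t} e"
    and Ee: "\<And>x y. 0 \<le> x \<Longrightarrow> x \<le> y \<Longrightarrow> y \<le> t \<Longrightarrow> E y - E x = integral {x..y} e"
    and w: "\<And>k i. i \<le> Suc k \<Longrightarrow> w (ugrid t k i) = z (ugrid t k i) - integral {0..ugrid t k i} p"
  shows "(\<lambda>k. \<Sum>i<Suc k. E (ugrid t k i) * (w (ugrid t k (Suc i)) - w (ugrid t k i)))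
    \<longlonglongrightarrow> E t * z t - integral {0..t} (\<lambda>u. z u * e u) - integral {0..t} (\<lambda>u. E u * p u)"
proof -
  have "(\<Sum>i<Suc k. E (ugrid t k i) * (w (ugrid t k (Suc i)) - w (ugrid t k i)))
     = E t * z t - (\<Sum>i<Suc k. z (ugrid t k (Suc i)) * integral {ugrid t k i..ugrid t k (Suc i)} e)
       - (\<Sum>i<Suc k. E (ugrid t k i) * integral {ugrid t k i..ugrid t k (Suc i)} p)" for k
  proof -
    let ?u = "ugrid t k"
    \<comment> \<open>Discrete product rule: the increment of \<open>E z\<close> is \<open>E\<close>
      at the left end times the increment of \<open>z\<close>, plus \<open>z\<close> at the right
      end times the increment of \<open>E\<close>. The first part telescopes, and the increments of
      \<open>E\<close> are integrals of \<open>e\<close>.\<close>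
    have "E (?u i) * (w (?u (Suc i)) - w (?u i)) = (E (?u (Suc i)) * z (?u (Suc i)) - E (?u i) * z (?u i))
        - z (?u (Suc i)) * integral {?u i..?u (Suc i)} e - E (?u i) * integral {?u i..?u (Suc i)} p"
      if i: "i < Suc k" for i
    proof -
      have b: "0 \<le> ?u i" "?u i \<le> ?u (Suc i)" "?u (Suc i) \<le> t"
        using ugrid_bounds[OF t, of i k] ugrid_bounds[OF t, of "Suc i" k] ugrid_mono[OF t, of i "Suc i" k] i by auto
      have "integral {0..?u i} p + integral {?u i..?u (Suc i)} p = integral {0..?u (Suc i)} p"
        using b by (intro Henstock_Kurzweil_Integration.integral_combine integrable_continuous_interval continuous_on_subset[OF p]) auto
      then have d: "w (?u (Suc i)) - w (?u i) = z (?u (Suc i)) - z (?u i) - integral {?u i..?u (Suc i)} p"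
        using w[of i k] w[of "Suc i" k] i by simp
      show ?thesis unfolding d Ee[OF b, symmetric] by (simp add: algebra_simps)
    qed
    then have "(\<Sum>i<Suc k. E (?u i) * (w (?u (Suc i)) - w (?u i)))
      = (\<Sum>i<Suc k. (E (?u (Suc i)) * z (?u (Suc i)) - E (?u i) * z (?u i))
        - z (?u (Suc i)) * integral {?u i..?u (Suc i)} e - E (?u i) * integral {?u i..?u (Suc i)} p)"
      by (intro sum.cong) auto
    also have "\<dots> = (E (?u (Suc k)) * z (?u (Suc k)) - E (?u 0) * z (?u 0))
       - (\<Sum>i<Suc k. z (?u (Suc i)) * integral {?u i..?u (Suc i)} e) - (\<Sum>i<Suc k. E (?u i) * integral {?u i..?u (Suc i)} p)"
      using sum_lessThan_telescope[of "\<lambda>i. E (?u i) * z (?u i)" "Suc k"] unfolding sum_subtractf by (simp only:)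
    finally show ?thesis using z(2) by simp
  qed
  moreover have "(\<lambda>k. E t * z t - (\<Sum>i<Suc k. z (ugrid t k (Suc i)) * integral {ugrid t k i..ugrid t k (Suc i)} e)
       - (\<Sum>i<Suc k. E (ugrid t k i) * integral {ugrid t k i..ugrid t k (Suc i)} p))
    \<longlonglongrightarrow> E t * z t - integral {0..t} (\<lambda>u. z u * e u) - integral {0..t} (\<lambda>u. E u * p u)"
    by (intro tendsto_diff tendsto_const riemann_tagged_tendsto z p E e t) (auto intro: ugrid_mono[OF t])
  ultimately show ?thesis by simp
qed

lemma abs_diff_step_le:
  fixes \<phi> \<tau> :: "_ \<Rightarrow> real"
  assumes "mono_on {..n} \<tau>" "u \<in> {\<tau> 0<..\<tau> n}"
    and le: "\<And>i. i < n \<Longrightarrow> u \<in> {\<tau> i<..\<tau> (Suc i)} \<Longrightarrow> \<bar>\<phi> u - \<phi> (\<tau> i)\<bar> \<le> \<eta>"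
  shows "\<bar>\<phi> u - (\<Sum>i<n. \<phi> (\<tau> i) * indicator {\<tau> i<..\<tau> (Suc i)} u)\<bar> \<le> \<eta>"
proof -
  let ?J = "\<lambda>i. {\<tau> i<..\<tau> (Suc i)}"
  have one: "(\<Sum>i<n. indicator (?J i) u) = (1::real)"
    using sum_indicator_grid[of n \<tau> u] assms by simp
  have "\<phi> u - (\<Sum>i<n. \<phi> (\<tau> i) * indicator (?J i) u)
    = \<phi> u * (\<Sum>i<n. indicator (?J i) u) - (\<Sum>i<n. \<phi> (\<tau> i) * indicator (?J i) u)"
    unfolding one by simp
  also have "\<dots> = (\<Sum>i<n. (\<phi> u - \<phi> (\<tau> i)) * indicator (?J i) u)"
    unfolding sum_distrib_left left_diff_distrib sum_subtractf ..
  finally have "\<bar>\<phi> u - (\<Sum>i<n. \<phi> (\<tau> i) * indicator (?J i) u)\<bar>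
    \<le> (\<Sum>i<n. \<bar>(\<phi> u - \<phi> (\<tau> i)) * indicator (?J i) u\<bar>)"
    by (simp only: sum_abs)
  also have "\<dots> \<le> (\<Sum>i<n. \<eta> * indicator (?J i) u)"
  proof (rule sum_mono)
    fix i assume "i \<in> {..<n}"
    then show "\<bar>(\<phi> u - \<phi> (\<tau> i)) * indicator (?J i) u\<bar> \<le> \<eta> * indicator (?J i) u"
      using le[of i] by (cases "u \<in> ?J i") auto
  qed
  also have "\<dots> = \<eta>" unfolding sum_distrib_left[symmetric] one by simp
  finally show ?thesis .
qed

lemma indicator_mult_borel:
  fixes f :: "real \<Rightarrow> real"
  assumes "continuous_on {a..b} f"
  shows "(\<lambda>u. indicator {a..b} u * f u) \<in> borel_measurable lborel"
  using borel_measurable_continuous_on_indicator[OF _ assms] by simp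

section \<open>Wiener integrals as limits of weighted increments\<close>

context standard_wiener_process
begin

text \<open>A weighted sum of increments of \<open>I\<close> pairs with \<open>f\<close> times a
  step function built from \<open>E\<close>. These integrands converge in L2 by uniform continuity
  of \<open>E\<close> and boundedness of \<open>f\<close>; the sums converge almost surely by
  hypothesis, hence in probability. Closedness then makes the limit \<open>V\<close> a version of
  the integral of \<open>E f\<close>.\<close>

lemma wiener_pair_weighted_increments:
  assumes t: "0 \<le> t" and f: "continuous_on {0..t} f" and E: "continuous_on {0..t} E"
    and I: "\<And>s. s \<in> {0..t} \<Longrightarrow> has_wiener_integral M B f s (I s)"
    and V[measurable]: "V \<in> borel_measurable M"
    and lim: "AE \<omega> in M. (\<lambda>k. \<Sum>i<Suc k. E (ugrid t k i) * (I (ugrid t k (Suc i)) \<omega> - I (ugrid t k i) \<omega>)) \<longlonglongrightarrow> V \<omega>"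
  shows "wiener_pair (\<lambda>u. indicator {0..t} u * (E u * f u)) V"
proof (rule wiener_pair_closed)
  have meas[measurable]: "(\<lambda>u. indicator {0..s} u * f u) \<in> borel_measurable lborel" if "s \<in> {0..t}" for s
    by (rule indicator_mult_borel) (use that in \<open>auto intro: continuous_on_subset[OF f]\<close>)
  show [measurable]: "(\<lambda>u. indicator {0..t} u * (E u * f u)) \<in> borel_measurable lborel"
    by (intro indicator_mult_borel continuous_intros E f)
  define g where "g k u = (\<Sum>i<Suc k. E (ugrid t k i) * (indicator {0..ugrid t k (Suc i)} u * f u - indicator {0..ugrid t k i} u * f u))" for k u
  define X where "X k \<omega> = (\<Sum>i<Suc k. E (ugrid t k i) * (I (ugrid t k (Suc i)) \<omega> - I (ugrid t k i) \<omega>))" for k \<omega>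
  have wp: "wiener_pair (g k) (X k)" for k
    unfolding g_def X_def
  proof (intro wiener_pair_sum wiener_pair_scale wiener_pair_diff)
    fix i assume "i \<in> {..<Suc k}"
    then have "ugrid t k i \<in> {0..t}" "ugrid t k (Suc i) \<in> {0..t}"
      using ugrid_bounds[OF t] by auto
    then show "wiener_pair (\<lambda>u. indicator {0..ugrid t k (Suc i)} u * f u) (I (ugrid t k (Suc i)))"
       "wiener_pair (\<lambda>u. indicator {0..ugrid t k i} u * f u) (I (ugrid t k i))"
      by (auto intro!: has_wiener_integral_wiener_pair I meas)
  qed
  note [measurable] = wiener_pair_measurable[OF wp]
  have g: "g k u = (\<Sum>i<Suc k. E (ugrid t k i) * indicator {ugrid t k i<..ugrid t k (Suc i)} u) * f u" for k u
    unfolding g_def sum_distrib_right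
  proof (intro sum.cong refl)
    fix i assume "i \<in> {..<Suc k}"
    have "0 \<le> ugrid t k i" "ugrid t k i \<le> ugrid t k (Suc i)"
      using ugrid_mono[OF t, of 0 i k] ugrid_mono[OF t, of i "Suc i" k] by auto
    then show "E (ugrid t k i) * (indicator {0..ugrid t k (Suc i)} u * f u - indicator {0..ugrid t k i} u * f u)
      = E (ugrid t k i) * indicator {ugrid t k i<..ugrid t k (Suc i)} u * f u"
      by (auto simp: indicator_def)
  qed
  obtain C where C: "C > 0" "\<And>u. u \<in> {0..t} \<Longrightarrow> \<bar>f u\<bar> \<le> C"
  proof -
    have "compact (f ` {0..t})" by (intro compact_continuous_image f) simp
    then have "bounded (f ` {0..t})" by (rule compact_imp_bounded)
    then show ?thesis using that by (auto simp: bounded_pos)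
  qed
  have lim1: "(\<lambda>k. \<integral>\<^sup>+u. ennreal ((indicator {0..t} u * (E u * f u) - g k u)\<^sup>2) \<partial>lborel) \<longlonglongrightarrow> 0"
  proof (rule order_tendstoI)
    fix \<epsilon> :: ennreal assume "0 < \<epsilon>"
    then obtain e where e: "0 < e" "ennreal e < \<epsilon>"
    proof (cases \<epsilon>)
      case (real r)
      then show ?thesis using \<open>0 < \<epsilon>\<close> that[of "r / 2"] by (simp add: ennreal_less_iff)
    next
      case top
      then show ?thesis using that[of 1] by simp
    qed
    \<comment> \<open>Chosen so that the squared error \<open>(\<eta> * C)\<^sup>2 * t\<close>
      equals \<open>e * (t / (t + 1))\<close>, which is at most \<open>e\<close>; the summand 1
      covers \<open>t = 0\<close>.\<close>
    define \<eta> where "\<eta> = sqrt (e / (C\<^sup>2 * (t + 1)))"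
    have \<eta>: "\<eta> > 0" "\<eta>\<^sup>2 = e / (C\<^sup>2 * (t + 1))" using C(1) t e by (auto simp: \<eta>_def)
    have "\<forall>\<^sub>F k in sequentially. \<forall>i<Suc k. \<forall>x\<in>{ugrid t k i..ugrid t k (Suc i)}. \<forall>y\<in>{ugrid t k i..ugrid t k (Suc i)}. \<bar>E x - E y\<bar> < \<eta>"
      by (rule eventually_ugrid_uniform[OF E t \<eta>(1)])
    then show "\<forall>\<^sub>F k in sequentially. (\<integral>\<^sup>+u. ennreal ((indicator {0..t} u * (E u * f u) - g k u)\<^sup>2) \<partial>lborel) < \<epsilon>"
    proof eventually_elim
      case (elim k)
      \<comment> \<open>The half-open cells miss the point 0, where the step approximation vanishes;
        this single point is a null set.\<close>
      have pw: "(indicator {0..t} u * (E u * f u) - g k u)\<^sup>2 \<le> (\<eta> * C)\<^sup>2 * indicator {0..t} u" if "u \<noteq> 0" for u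
      proof (cases "u \<in> {0<..t}")
        case True
        have "\<bar>E u - (\<Sum>i<Suc k. E (ugrid t k i) * indicator {ugrid t k i<..ugrid t k (Suc i)} u)\<bar> \<le> \<eta>"
        proof (rule abs_diff_step_le)
          show "mono_on {..Suc k} (ugrid t k)" using ugrid_mono[OF t] by (simp add: mono_on_def)
          show "u \<in> {ugrid t k 0<..ugrid t k (Suc k)}" using True by simp
          fix i assume i: "i < Suc k" and u: "u \<in> {ugrid t k i<..ugrid t k (Suc i)}"
          then have "u \<in> {ugrid t k i..ugrid t k (Suc i)}" "ugrid t k i \<in> {ugrid t k i..ugrid t k (Suc i)}"
            by auto
          then show "\<bar>E u - E (ugrid t k i)\<bar> \<le> \<eta>" using elim i less_imp_le by blast
        qed
        then have "\<bar>E u - (\<Sum>i<Suc k. E (ugrid t k i) * indicator {ugrid t k i<..ugrid t k (Suc i)} u)\<bar> * \<bar>f u\<bar> \<le> \<eta> * C"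
          using C True \<eta>(1) by (intro mult_mono) auto
        also have "\<bar>E u - (\<Sum>i<Suc k. E (ugrid t k i) * indicator {ugrid t k i<..ugrid t k (Suc i)} u)\<bar> * \<bar>f u\<bar>
          = \<bar>indicator {0..t} u * (E u * f u) - g k u\<bar>"
          using True unfolding g abs_mult[symmetric] left_diff_distrib by (simp only: indicator_def) simp
        finally show ?thesis
          using True C(1) \<eta>(1) abs_le_square_iff[of "indicator {0..t} u * (E u * f u) - g k u" "\<eta> * C"]
          by (simp add: abs_mult)
      next
        case False
        have "(\<Sum>i<Suc k. E (ugrid t k i) * indicator {ugrid t k i<..ugrid t k (Suc i)} u) = 0"
        proof (intro sum.neutral ballI)
          fix i assume "i \<in> {..<Suc k}"
          then have "0 \<le> ugrid t k i" "ugrid t k (Suc i) \<le> t"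
            using ugrid_bounds[OF t, of i k] ugrid_bounds[OF t, of "Suc i" k] by auto
          then show "E (ugrid t k i) * indicator {ugrid t k i<..ugrid t k (Suc i)} u = 0"
            using False by (auto simp: indicator_def)
        qed
        then show ?thesis using False that by (auto simp: g indicator_def)
      qed
      have "(\<integral>\<^sup>+u. ennreal ((indicator {0..t} u * (E u * f u) - g k u)\<^sup>2) \<partial>lborel)
        \<le> (\<integral>\<^sup>+u. ennreal ((\<eta> * C)\<^sup>2) * indicator {0..t} u \<partial>lborel)"
      proof (rule nn_integral_mono_AE)
        show "AE u in lborel. ennreal ((indicator {0..t} u * (E u * f u) - g k u)\<^sup>2) \<le> ennreal ((\<eta> * C)\<^sup>2) * indicator {0..t} u"
          using AE_lborel_singleton[of 0]
        proof eventually_elim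
          case (elim u)
          have "ennreal ((\<eta> * C)\<^sup>2) * indicator {0..t} u = ennreal ((\<eta> * C)\<^sup>2 * indicator {0..t} u)"
            by (simp add: indicator_def)
          then show ?case using pw[OF elim] by (simp only: ennreal_leI)
        qed
      qed
      also have "\<dots> = ennreal ((\<eta> * C)\<^sup>2 * t)"
        using t by (subst nn_integral_cmult_indicator) (simp_all flip: ennreal_mult')
      also have "(\<eta> * C)\<^sup>2 * t = e * (t / (t + 1))"
        using C(1) t e unfolding power_mult_distrib \<eta>(2) by simp
      also have "ennreal (e * (t / (t + 1))) \<le> ennreal e"
        using t e by (intro ennreal_leI mult_left_le) auto
      also note e(2)
      finally show ?case .
    qed
  qed simp
  \<comment> \<open>The truncation supplies the constant 1 as a dominating function on a probability
    space.\<close>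
  have lim2: "(\<lambda>k. \<integral>\<^sup>+\<omega>. ennreal (min 1 ((V \<omega> - X k \<omega>)\<^sup>2)) \<partial>M) \<longlonglongrightarrow> (\<integral>\<^sup>+\<omega>. 0 \<partial>M)"
  proof (rule nn_integral_dominated_convergence[where w="\<lambda>_. 1"])
    show "AE \<omega> in M. (\<lambda>k. ennreal (min 1 ((V \<omega> - X k \<omega>)\<^sup>2))) \<longlonglongrightarrow> 0"
      using lim
    proof eventually_elim
      case (elim \<omega>)
      then have "(\<lambda>k. X k \<omega>) \<longlonglongrightarrow> V \<omega>" by (simp add: X_def)
      then have "(\<lambda>k. ennreal (min 1 ((V \<omega> - X k \<omega>)\<^sup>2))) \<longlonglongrightarrow> ennreal (min 1 ((V \<omega> - V \<omega>)\<^sup>2))"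
        by (intro tendsto_intros)
      then show ?case by simp
    qed
  qed (auto simp: emeasure_space_1 intro!: AE_I2)
  fix \<epsilon> :: ennreal assume "0 < \<epsilon>"
  have "(\<lambda>k. wnorm (\<lambda>u. indicator {0..t} u * (E u * f u) - g k u) (\<lambda>\<omega>. V \<omega> - X k \<omega>)) \<longlonglongrightarrow> 0 + 0"
    unfolding wnorm_def using lim2 by (intro tendsto_add lim1) simp
  then have "eventually (\<lambda>k. wnorm (\<lambda>u. indicator {0..t} u * (E u * f u) - g k u) (\<lambda>\<omega>. V \<omega> - X k \<omega>) < \<epsilon>) sequentially"
    using \<open>0 < \<epsilon>\<close> by (intro order_tendstoD(2)) auto
  then show "\<exists>g Y. wiener_pair g Y \<and> wnorm (\<lambda>u. indicator {0..t} u * (E u * f u) - g u) (\<lambda>\<omega>. V \<omega> - Y \<omega>) < \<epsilon>"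
    using wp unfolding eventually_sequentially by blast
qed (rule V)

end

section \<open>The linear equation\<close>

locale linear_coefficients =
  fixes q \<sigma> :: "real \<Rightarrow> real"
  assumes q: "continuous_on {0..} q" and \<sigma>: "continuous_on {0..} \<sigma>"
begin

definition \<kappa> :: "real \<Rightarrow> real" where "\<kappa> u = exp (- qbar q u) * \<sigma> u"
text \<open>The intrinsic clock: discounted and centred, a solution started at 0 is a Wiener process
  run at time \<open>v t\<close>, and the bridge formulas turn into those of the Brownian
  bridge.\<close>

definition v :: "real \<Rightarrow> real" where "v t = integral {0..t} (\<lambda>u. (\<kappa> u)\<^sup>2)"

lemma cont_q: "0 \<le> a \<Longrightarrow> continuous_on {a..b} q"
  by (rule continuous_on_subset[OF q]) auto

lemma cont_\<sigma>: "0 \<le> a \<Longrightarrow> continuous_on {a..b} \<sigma>"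
  by (rule continuous_on_subset[OF \<sigma>]) auto

lemma qbar_0 [simp]: "qbar q 0 = 0"
  by (simp add: qbar_def)

lemma qbar_deriv: "0 \<le> a \<Longrightarrow> x \<in> {a..b} \<Longrightarrow> (qbar q has_real_derivative q x) (at x within {a..b})"
  unfolding qbar_def[abs_def]
  by (rule DERIV_subset[OF integral_has_real_derivative[of 0 b]]) (auto intro: cont_q)

lemma cont_qbar: "0 \<le> a \<Longrightarrow> continuous_on {a..b} (qbar q)"
  by (rule DERIV_continuous_on[OF qbar_deriv])

lemma cont_\<kappa>: "0 \<le> a \<Longrightarrow> continuous_on {a..b} \<kappa>"
  unfolding \<kappa>_def by (intro continuous_intros cont_qbar cont_\<sigma>)

lemma exp_neg_qbar_diff:
  assumes "0 \<le> x" "x \<le> y"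
  shows "exp (- qbar q y) - exp (- qbar q x) = integral {x..y} (\<lambda>u. - q u * exp (- qbar q u))"
proof -
  have "((\<lambda>u. - q u * exp (- qbar q u)) has_integral (exp (- qbar q y) - exp (- qbar q x))) {x..y}"
  proof (rule fundamental_theorem_of_calculus[OF assms(2)])
    fix u assume "u \<in> {x..y}"
    then show "((\<lambda>u. exp (- qbar q u)) has_vector_derivative - q u * exp (- qbar q u)) (at u within {x..y})"
      unfolding has_real_derivative_iff_has_vector_derivative[symmetric]
      using assms(1) by (auto intro!: derivative_eq_intros qbar_deriv)
  qed
  then show ?thesis by (rule integral_unique[symmetric])
qed

lemma v_0 [simp]: "v 0 = 0"
  by (simp add: v_def)

lemma v_deriv: "0 \<le> a \<Longrightarrow> x \<in> {a..b} \<Longrightarrow> (v has_real_derivative (\<kappa> x)\<^sup>2) (at x within {a..b})"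
  unfolding v_def[abs_def]
  by (rule DERIV_subset[OF integral_has_real_derivative[of 0 b]]) (auto intro!: continuous_intros cont_\<kappa>)

lemma cont_v: "0 \<le> a \<Longrightarrow> continuous_on {a..b} v"
  by (rule DERIV_continuous_on[OF v_deriv])

lemma v_diff:
  assumes "0 \<le> s" "s \<le> t"
  shows "integral {s..t} (\<lambda>u. (\<kappa> u)\<^sup>2) = v t - v s"
proof -
  have "(\<lambda>u. (\<kappa> u)\<^sup>2) integrable_on {0..t}"
    by (intro integrable_continuous_interval continuous_intros cont_\<kappa>) simp
  from Henstock_Kurzweil_Integration.integral_combine[OF assms this] show ?thesis
    by (simp add: v_def)
qed

text \<open>Separates an exponential factor from an increment of the clock, so that the remaining
  identities about \<gamma> reduce to algebra in \<open>v\<close> and \<open>exp\<close>.\<close>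

lemma cond_var_eq:
  assumes "0 \<le> s" "s \<le> t"
  shows "cond_var q \<sigma> s t = exp (2 * qbar q t) * (v t - v s)"
proof -
  have "exp (2 * (qbar q t - qbar q u)) * (\<sigma> u)\<^sup>2 = exp (2 * qbar q t) * (\<kappa> u)\<^sup>2" for u
    by (simp add: \<kappa>_def power_mult_distrib exp_double[symmetric] right_diff_distrib exp_diff exp_minus field_simps)
  then show ?thesis unfolding cond_var_def using v_diff[OF assms] by simp
qed

lemma lborel_integral_\<kappa>:
  assumes "0 \<le> t"
  shows "integrable lborel (\<lambda>u. indicator {0..t} u * (\<kappa> u)\<^sup>2)"
    and "(LINT u|lborel. indicator {0..t} u * (\<kappa> u)\<^sup>2) = v t"
proof -
  show "integrable lborel (\<lambda>u. indicator {0..t} u * (\<kappa> u)\<^sup>2)"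
    using borel_integrable_atLeastAtMost'[of 0 t "\<lambda>u. (\<kappa> u)\<^sup>2"]
    by (auto simp: set_integrable_def intro!: continuous_intros cont_\<kappa>)
  have "(LINT u|lborel. indicator {0..t} u *\<^sub>R (\<kappa> u)\<^sup>2) = v t - v 0"
    using assms by (intro integral_FTC_atLeastAtMost)
      (auto simp: has_real_derivative_iff_has_vector_derivative[symmetric] intro!: v_deriv continuous_intros cont_\<kappa>)
  then show "(LINT u|lborel. indicator {0..t} u * (\<kappa> u)\<^sup>2) = v t" by simp
qed

lemma cond_mean_eq:
  assumes r: "continuous_on {0..} r" and s: "0 \<le> s" "s \<le> t"
  shows "cond_mean q r x s t = exp (qbar q t - qbar q s) * x + exp (qbar q t) * integral {s..t} (\<lambda>u. exp (- qbar q u) * r u)"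
proof -
  have "exp (qbar q t - qbar q u) * r u = exp (qbar q t) * (exp (- qbar q u) * r u)" for u
    by (simp add: exp_diff exp_minus field_simps)
  then show ?thesis unfolding cond_mean_def by (simp only: integral_mult_right)
qed

end

lemma integral_square_sum:
  fixes f :: "'i \<Rightarrow> real \<Rightarrow> real"
  assumes "finite J" "\<And>s. s \<in> J \<Longrightarrow> f s \<in> borel_measurable lborel" "\<And>s. s \<in> J \<Longrightarrow> integrable lborel (\<lambda>u. (f s u)\<^sup>2)"
  shows "(LINT u|lborel. (\<Sum>s\<in>J. \<theta> s * f s u)\<^sup>2) = (\<Sum>s\<in>J. \<Sum>t\<in>J. \<theta> s * \<theta> t * (LINT u|lborel. f s u * f t u))"
proof -
  have int: "integrable lborel (\<lambda>u. f s u * f t u)" if "s \<in> J" "t \<in> J" for s t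
  proof (rule Bochner_Integration.integrable_bound)
    show "integrable lborel (\<lambda>u. (f s u)\<^sup>2 + (f t u)\<^sup>2)" using assms(3) that by simp
    show "(\<lambda>u. f s u * f t u) \<in> borel_measurable lborel" using assms(2) that by simp
    have "\<bar>x * y\<bar> \<le> x\<^sup>2 + y\<^sup>2" for x y :: real
      using sum_squares_bound[of "\<bar>x\<bar>" "\<bar>y\<bar>"] mult_nonneg_nonneg[of "\<bar>x\<bar>" "\<bar>y\<bar>"]
      unfolding abs_mult by (simp only: power2_abs) linarith
    then show "AE u in lborel. norm (f s u * f t u) \<le> norm ((f s u)\<^sup>2 + (f t u)\<^sup>2)" by simp
  qed
  have "(LINT u|lborel. (\<Sum>s\<in>J. \<theta> s * f s u)\<^sup>2) = (LINT u|lborel. (\<Sum>s\<in>J. \<Sum>t\<in>J. \<theta> s * \<theta> t * (f s u * f t u)))"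
    unfolding power2_eq_square sum_product by (intro Bochner_Integration.integral_cong sum.cong refl) simp
  also have "\<dots> = (\<Sum>s\<in>J. \<Sum>t\<in>J. \<theta> s * \<theta> t * (LINT u|lborel. f s u * f t u))"
    using int by (simp add: Bochner_Integration.integral_sum)
  finally show ?thesis .
qed

section \<open>The solution as a Wiener integral; moments and joint laws\<close>

context standard_wiener_process
begin

text \<open>Variation of constants with the integrating factor \<open>exp (- qbar q t)\<close>,
  carried out path by path. Its derivative contributes a term that cancels the drift
  \<open>q u * Z u\<close>, leaving only the deterministic part of the drift, which is the
  mean.\<close>

lemma linear_sde_solution_wiener_pair:
  assumes q: "continuous_on {0..} q" and r: "continuous_on {0..} r" and \<sigma>: "continuous_on {0..} \<sigma>"
    and Z: "linear_sde_solution M B q r \<sigma> Z" and Z0: "AE \<omega> in M. Z 0 \<omega> = 0" and t: "0 \<le> t"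
  shows "wiener_pair (\<lambda>u. indicator {0..t} u * (exp (- qbar q u) * \<sigma> u))
    (\<lambda>\<omega>. exp (- qbar q t) * (Z t \<omega> - cond_mean q r 0 0 t))"
proof -
  interpret linear_coefficients q \<sigma> by unfold_locales fact+
  have r': "continuous_on {a..b} r" if "0 \<le> a" for a b
    by (rule continuous_on_subset[OF r]) (use that in auto)
  have Zm[measurable]: "Z s \<in> borel_measurable M" if "0 \<le> s" for s
    using Z that by (auto simp: linear_sde_solution_def)
  have "\<forall>s\<in>{0..}. \<exists>I. has_wiener_integral M B \<sigma> s I \<and>
        (AE \<omega> in M. Z s \<omega> = Z 0 \<omega> + integral {0..s} (\<lambda>u. q u * Z u \<omega> + r u) + I \<omega>)"
    using Z by (simp add: linear_sde_solution_def)
  then obtain I where *: "\<forall>s\<in>{0..}. has_wiener_integral M B \<sigma> s (I s) \<and>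
        (AE \<omega> in M. Z s \<omega> = Z 0 \<omega> + integral {0..s} (\<lambda>u. q u * Z u \<omega> + r u) + I s \<omega>)"
    by (rule bchoice[THEN exE])
  have I: "has_wiener_integral M B \<sigma> s (I s)"
    and ZI: "AE \<omega> in M. Z s \<omega> = Z 0 \<omega> + integral {0..s} (\<lambda>u. q u * Z u \<omega> + r u) + I s \<omega>" if "0 \<le> s" for s
    using * that by simp_all
  \<comment> \<open>The null set of the equation depends on the time. Only the countably many grid
    points are needed, so one null set suffices for all of them.\<close>
  have grid: "AE \<omega> in M. \<forall>k i. Z (ugrid t k i) \<omega> = Z 0 \<omega>
      + integral {0..ugrid t k i} (\<lambda>u. q u * Z u \<omega> + r u) + I (ugrid t k i) \<omega>"
    unfolding AE_all_countable using ugrid_mono[OF t, of 0] by (auto intro!: ZI)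
  have cont: "AE \<omega> in M. continuous_on {0..} (\<lambda>s. Z s \<omega>)"
    using Z by (simp add: linear_sde_solution_def)
  show ?thesis
  proof (rule wiener_pair_weighted_increments[OF t])
    show "AE \<omega> in M. (\<lambda>k. \<Sum>i<Suc k. exp (- qbar q (ugrid t k i)) * (I (ugrid t k (Suc i)) \<omega> - I (ugrid t k i) \<omega>))
        \<longlonglongrightarrow> exp (- qbar q t) * (Z t \<omega> - cond_mean q r 0 0 t)"
      using grid cont Z0
    proof eventually_elim
      case (elim \<omega>)
      define z where "z s = Z s \<omega>" for s
      have z: "continuous_on {a..b} z" if "0 \<le> a" for a b
        unfolding z_def by (rule continuous_on_subset[OF elim(2)]) (use that in auto)
      note c = cont_q r' cont_qbar z
      have "(\<lambda>k. \<Sum>i<Suc k. exp (- qbar q (ugrid t k i)) * (I (ugrid t k (Suc i)) \<omega> - I (ugrid t k i) \<omega>))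
        \<longlonglongrightarrow> exp (- qbar q t) * z t - integral {0..t} (\<lambda>u. z u * (- q u * exp (- qbar q u)))
          - integral {0..t} (\<lambda>u. exp (- qbar q u) * (q u * z u + r u))"
      proof (rule weighted_increments_tendsto[OF t])
        show "z 0 = 0" using elim(3) by (simp add: z_def)
        show "I (ugrid t k i) \<omega> = z (ugrid t k i) - integral {0..ugrid t k i} (\<lambda>u. q u * z u + r u)" for k i
          using elim(1,3) by (simp add: z_def)
        show "exp (- qbar q y) - exp (- qbar q x) = integral {x..y} (\<lambda>u. - q u * exp (- qbar q u))"
          if "0 \<le> x" "x \<le> y" for x y
          using that by (rule exp_neg_qbar_diff)
      qed (auto intro!: continuous_intros c)
      also have "exp (- qbar q t) * z t - integral {0..t} (\<lambda>u. z u * (- q u * exp (- qbar q u)))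
          - integral {0..t} (\<lambda>u. exp (- qbar q u) * (q u * z u + r u))
        = exp (- qbar q t) * z t - (integral {0..t} (\<lambda>u. z u * (- q u * exp (- qbar q u)))
          + integral {0..t} (\<lambda>u. exp (- qbar q u) * (q u * z u + r u)))" by simp
      also have "integral {0..t} (\<lambda>u. z u * (- q u * exp (- qbar q u)))
          + integral {0..t} (\<lambda>u. exp (- qbar q u) * (q u * z u + r u))
        = integral {0..t} (\<lambda>u. z u * (- q u * exp (- qbar q u)) + exp (- qbar q u) * (q u * z u + r u))"
        by (subst Henstock_Kurzweil_Integration.integral_add)
           (auto intro!: integrable_continuous_interval continuous_intros c)
      \<comment> \<open>The terms with \<open>q u * z u\<close> cancel; this is what the choice of
        integrating factor achieves.\<close>
      also have "\<dots> = integral {0..t} (\<lambda>u. exp (- qbar q u) * r u)"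
        by (simp add: algebra_simps)
      also have "exp (- qbar q t) * z t - integral {0..t} (\<lambda>u. exp (- qbar q u) * r u)
        = exp (- qbar q t) * (Z t \<omega> - cond_mean q r 0 0 t)"
        unfolding cond_mean_eq[OF r order_refl t] z_def by (simp add: exp_minus right_diff_distrib)
      finally show ?case .
    qed
  qed (use t in \<open>auto intro!: continuous_intros cont_qbar cont_\<sigma> I\<close>)
qed

text \<open>Convergence in probability does not transport moments. Instead the characteristic
  function identifies the law of \<open>X\<close> with that of \<open>s\<close> times a standard
  normal variable, whose moments are known; writing the law this way includes the degenerate case
  \<open>s = 0\<close>.\<close>

lemma wiener_pair_moments:
  assumes fX: "wiener_pair f X"
  shows "integrable M X" "(LINT \<omega>|M. X \<omega>) = 0" "(LINT \<omega>|M. (X \<omega>)\<^sup>2) = (LINT u|lborel. (f u)\<^sup>2)"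
proof -
  note [measurable] = wiener_pair_measurable[OF fX]
  define s where "s = sqrt (LINT u|lborel. (f u)\<^sup>2)"
  have s2: "s\<^sup>2 = (LINT u|lborel. (f u)\<^sup>2)" by (simp add: s_def)
  define N where "N = std_normal_distribution"
  interpret N: real_distribution N unfolding N_def by (rule real_dist_normal_dist)
  have mom1: "integrable N (\<lambda>x. x)" "(LINT x|N. x) = 0"
    unfolding N_def using integrable_std_normal_moment[of 1] integral_std_normal_moment_odd[of 0]
    by (simp_all add: integrable_density integral_density)
  have mom2: "(LINT x|N. x\<^sup>2) = 1"
    unfolding N_def using integral_std_normal_moment_even[of 1] by (simp add: integral_density)
  have [measurable]: "(\<lambda>x. s * x) \<in> borel_measurable N" by simp
  have eq: "distr M borel X = distr N borel (\<lambda>x. s * x)"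
  proof (rule Levy_uniqueness)
    show "real_distribution (distr M borel X)"
      by (simp add: real_distribution_def real_distribution_axioms_def prob_space_distr)
    show "real_distribution (distr N borel (\<lambda>x. s * x))"
      by (simp add: real_distribution_def real_distribution_axioms_def N.prob_space_distr)
    show "char (distr M borel X) = char (distr N borel (\<lambda>x. s * x))"
    proof
      fix t
      have "char (distr M borel X) t = (CLINT \<omega>|M. iexp (t * X \<omega>))"
        unfolding char_def by (rule integral_distr) measurable
      also have "\<dots> = exp (- ((LINT u|lborel. (t * f u)\<^sup>2) / 2))"
        by (rule wiener_pair_char[OF wiener_pair_scale[OF fX]])
      also have "(LINT u|lborel. (t * f u)\<^sup>2) = (t * s)\<^sup>2"
        by (simp add: power_mult_distrib s2)
      also have "exp (- ((t * s)\<^sup>2 / 2)) = exp (- (t * s)\<^sup>2 / 2)" by simp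
      also have "complex_of_real \<dots> = char N (t * s)"
        by (simp add: N_def char_std_normal_distribution)
      also have "\<dots> = char (distr N borel (\<lambda>x. s * x)) t"
        unfolding char_def by (subst integral_distr) (simp_all add: mult.assoc)
      finally show "char (distr M borel X) t = char (distr N borel (\<lambda>x. s * x)) t" .
    qed
  qed
  have "integrable N (\<lambda>x. s * x)" using mom1(1) by (rule integrable_mult_right)
  then have "integrable (distr N borel (\<lambda>x. s * x)) (\<lambda>x. x)"
    by (intro integrable_distr_eq[THEN iffD2]) measurable
  then have "integrable (distr M borel X) (\<lambda>x. x)" unfolding eq .
  then show "integrable M X" by (rule integrable_distr[rotated]) measurable
  have "(LINT \<omega>|M. X \<omega>) = (LINT x|distr M borel X. x)" by (rule integral_distr[symmetric]) measurable
  also have "\<dots> = (LINT x|N. s * x)" unfolding eq by (rule integral_distr) measurable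
  finally show "(LINT \<omega>|M. X \<omega>) = 0" using mom1(2) by simp
  have "(LINT \<omega>|M. (X \<omega>)\<^sup>2) = (LINT x|distr M borel X. x\<^sup>2)" by (rule integral_distr[symmetric]) measurable
  also have "\<dots> = (LINT x|N. (s * x)\<^sup>2)" unfolding eq by (rule integral_distr) measurable
  also have "\<dots> = s\<^sup>2" using mom2 by (simp add: power_mult_distrib)
  finally show "(LINT \<omega>|M. (X \<omega>)\<^sup>2) = (LINT u|lborel. (f u)\<^sup>2)" using s2 by simp
qed

text \<open>A linear combination of the variables is a constant plus a Wiener integral whose
  variance is a quadratic form in the Gram matrix of the integrands. The argument covers singular
  Gram matrices, such as those arising when \<open>J\<close> contains an end point of the
  interval.\<close>

theorem wiener_pair_equal_law:
  assumes J: "finite J"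
    and X: "\<And>t. t \<in> J \<Longrightarrow> wiener_pair (f t) (\<lambda>\<omega>. X t \<omega> - n t)"
    and Y: "\<And>t. t \<in> J \<Longrightarrow> wiener_pair (g t) (\<lambda>\<omega>. Y t \<omega> - n t)"
    and eq: "\<And>s t. s \<in> J \<Longrightarrow> t \<in> J \<Longrightarrow> (LINT u|lborel. f s u * f t u) = (LINT u|lborel. g s u * g t u)"
  shows "distr M (\<Pi>\<^sub>M t\<in>J. borel) (\<lambda>\<omega>. \<lambda>t\<in>J. X t \<omega>) = distr M (\<Pi>\<^sub>M t\<in>J. borel) (\<lambda>\<omega>. \<lambda>t\<in>J. Y t \<omega>)"
proof (rule char_determines_PiM[OF prob_space_axioms prob_space_axioms J])
  have meas: "V \<in> borel_measurable M" if "wiener_pair h (\<lambda>\<omega>. V \<omega> - c)" for h V and c :: real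
    using borel_measurable_add[OF wiener_pair_measurable(2)[OF that] borel_measurable_const[of c]] by simp
  show "X t \<in> borel_measurable M" "Y t \<in> borel_measurable M" if "t \<in> J" for t
    using meas[OF X[OF that]] meas[OF Y[OF that]] .
  fix \<theta>
  have ch: "(CLINT \<omega>|M. iexp (\<Sum>t\<in>J. \<theta> t * V t \<omega>)) = iexp (\<Sum>t\<in>J. \<theta> t * n t)
      * exp (- ((\<Sum>s\<in>J. \<Sum>t\<in>J. \<theta> s * \<theta> t * (LINT u|lborel. h s u * h t u)) / 2))"
    if V: "\<And>t. t \<in> J \<Longrightarrow> wiener_pair (h t) (\<lambda>\<omega>. V t \<omega> - n t)" for V h
  proof -
    have "(\<Sum>t\<in>J. \<theta> t * V t \<omega>) = (\<Sum>t\<in>J. \<theta> t * n t) + (\<Sum>t\<in>J. \<theta> t * (V t \<omega> - n t))" for \<omega>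
      by (simp add: sum.distrib[symmetric] algebra_simps)
    then have "(CLINT \<omega>|M. iexp (\<Sum>t\<in>J. \<theta> t * V t \<omega>))
      = (CLINT \<omega>|M. iexp (\<Sum>t\<in>J. \<theta> t * n t) * iexp (\<Sum>t\<in>J. \<theta> t * (V t \<omega> - n t)))"
      by (simp only: of_real_add distrib_left exp_add)
    also have "\<dots> = iexp (\<Sum>t\<in>J. \<theta> t * n t) * (CLINT \<omega>|M. iexp (\<Sum>t\<in>J. \<theta> t * (V t \<omega> - n t)))"
      by (rule integral_mult_right_zero)
    also have "(CLINT \<omega>|M. iexp (\<Sum>t\<in>J. \<theta> t * (V t \<omega> - n t))) = exp (- ((LINT u|lborel. (\<Sum>t\<in>J. \<theta> t * h t u)\<^sup>2) / 2))"
      by (intro wiener_pair_char wiener_pair_sum wiener_pair_scale V)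
    also have "(LINT u|lborel. (\<Sum>t\<in>J. \<theta> t * h t u)\<^sup>2) = (\<Sum>s\<in>J. \<Sum>t\<in>J. \<theta> s * \<theta> t * (LINT u|lborel. h s u * h t u))"
      by (intro integral_square_sum J wiener_pair_measurable[OF V] wiener_pair_integrable[OF V])
    finally show ?thesis .
  qed
  show "(CLINT \<omega>|M. iexp (\<Sum>t\<in>J. \<theta> t * X t \<omega>)) = (CLINT \<omega>|M. iexp (\<Sum>t\<in>J. \<theta> t * Y t \<omega>))"
  proof -
    have "(\<Sum>s\<in>J. \<Sum>t\<in>J. \<theta> s * \<theta> t * (LINT u|lborel. f s u * f t u))
      = (\<Sum>s\<in>J. \<Sum>t\<in>J. \<theta> s * \<theta> t * (LINT u|lborel. g s u * g t u))"
      by (intro sum.cong refl) (simp only: eq)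
    then show ?thesis using ch[of f X, OF X] ch[of g Y, OF Y] by (simp only:)
  qed
qed

end

section \<open>The bridge\<close>

lemma exp_mult_2: "exp (x * 2) = exp x * exp x" for x :: real
  by (simp add: mult_2_right flip: exp_add)

locale bridge_coefficients = linear_coefficients +
  fixes r :: "real \<Rightarrow> real" and T :: real
  assumes r: "continuous_on {0..} r" and \<sigma>_nonzero: "\<And>t. 0 \<le> t \<Longrightarrow> \<sigma> t \<noteq> 0" and T: "0 < T"
begin

text \<open>The integrands representing the centred parts of \<open>U t\<close> and \<open>Y t\<close>. At \<open>t = T\<close> the bridge kernel
  vanishes identically: its factor \<open>(v T - v t) / (v T - v u)\<close> is then \<open>0\<close>, at \<open>u = T\<close> by \<open>0 / 0 = 0\<close>.\<close>
definition bridge_kernel :: "real \<Rightarrow> real \<Rightarrow> real" where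
  "bridge_kernel t u = indicator {0..t} u * (exp (qbar q t) * ((v T - v t) / (v T - v u)) * \<kappa> u)"

definition anticipative_kernel :: "real \<Rightarrow> real \<Rightarrow> real" where
  "anticipative_kernel t u = exp (qbar q t) * (indicator {0..t} u * \<kappa> u)
     - exp (qbar q t) * (v t / v T) * (indicator {0..T} u * \<kappa> u)"

definition \<rho> :: "real \<Rightarrow> real" where "\<rho> t = integral {0..t} (\<lambda>u. exp (- qbar q u) * r u)"

text \<open>A continuous nonnegative integrand with integral zero would vanish on the whole
  interval, in particular at \<open>s\<close>, contradicting \<sigma> \<noteq> 0.\<close>

lemma v_less:
  assumes "0 \<le> s" "s < t"
  shows "v s < v t"
proof -
  have c: "continuous_on {s..t} (\<lambda>u. (\<kappa> u)\<^sup>2)" by (intro continuous_intros cont_\<kappa> assms)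
  have "integral {s..t} (\<lambda>u. (\<kappa> u)\<^sup>2) \<noteq> 0"
    using integral_eq_0_iff[OF c assms(2)] assms \<sigma>_nonzero[of s] by (auto simp: \<kappa>_def)
  moreover have "integral {s..t} (\<lambda>u. (\<kappa> u)\<^sup>2) \<ge> 0"
    by (rule integral_nonneg) (auto intro: integrable_continuous_interval c)
  ultimately show ?thesis using v_diff[of s t] assms by simp
qed

lemma v_T_pos: "0 < v T"
  using v_less[of 0 T] T by simp

text \<open>Up to the exponential factor this is the Brownian bridge covariance
  \<open>s * (T - t) / T\<close> with every time replaced by its value under the clock
  \<open>v\<close>.\<close>

lemma inner_bridge_kernel:
  assumes "0 \<le> s" "s \<le> t" "t \<le> T"
  shows "(LINT u|lborel. bridge_kernel s u * bridge_kernel t u)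
    = exp (qbar q s + qbar q t) * (v s * (v T - v t) / v T)"
proof (cases "t = T")
  \<comment> \<open>The antiderivative used in the other case would be singular at the right end if
    \<open>s = T\<close>. Here the kernel at \<open>T\<close> is zero, and so is the right
    side.\<close>
  case True
  then show ?thesis by (simp add: bridge_kernel_def)
next
  case False
  with assms have t: "t < T" by simp
  \<comment> \<open>Collects the factors of both kernels that do not depend on \<open>u\<close>;
    only the indicator of the shorter interval survives in the product.\<close>
  define c where "c = exp (qbar q s + qbar q t) * (v T - v s) * (v T - v t)"
  have pos: "v T - v u > 0" if "0 \<le> u" "u \<le> s" for u
    using v_less[of u T] that assms t by simp
  have "(LINT u|lborel. bridge_kernel s u * bridge_kernel t u)
    = (LINT u|lborel. indicator {0..s} u *\<^sub>R (c * (\<kappa> u)\<^sup>2 / (v T - v u)\<^sup>2))"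
    using assms by (intro Bochner_Integration.integral_cong refl)
      (auto simp: bridge_kernel_def c_def indicator_def exp_add power2_eq_square)
  also have "\<dots> = c / (v T - v s) - c / (v T - v 0)"
  proof (rule integral_FTC_atLeastAtMost[OF assms(1)])
    fix u assume u: "0 \<le> u" "u \<le> s"
    have "((\<lambda>u. c / (v T - v u)) has_real_derivative c * (\<kappa> u)\<^sup>2 / (v T - v u)\<^sup>2) (at u within {0..s})"
      using pos[OF u] u by (auto intro!: derivative_eq_intros v_deriv simp: power2_eq_square)
    then show "((\<lambda>u. c / (v T - v u)) has_vector_derivative c * (\<kappa> u)\<^sup>2 / (v T - v u)\<^sup>2) (at u within {0..s})"
      by (simp only: has_real_derivative_iff_has_vector_derivative)
  next
    show "continuous_on {0..s} (\<lambda>u. c * (\<kappa> u)\<^sup>2 / (v T - v u)\<^sup>2)"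
      using pos by (intro continuous_intros cont_\<kappa> cont_v) fastforce+
  qed
  also have "\<dots> = exp (qbar q s + qbar q t) * (v s * (v T - v t) / v T)"
    using pos[OF assms(1) order_refl] v_T_pos by (simp add: c_def field_simps)
  finally show ?thesis .
qed

text \<open>The coefficient \<open>v t / v T\<close> makes the kernel the residual of orthogonal
  projection onto \<kappa> restricted to the interval from 0 to \<open>T\<close>; in probabilistic
  terms, the residual of regressing \<open>Z t\<close> on \<open>Z T\<close>. After expansion the
  last two terms cancel upon integration.\<close>

lemma inner_anticipative_kernel:
  assumes "0 \<le> s" "s \<le> t" "t \<le> T"
  shows "(LINT u|lborel. anticipative_kernel s u * anticipative_kernel t u)
    = exp (qbar q s + qbar q t) * (v s * (v T - v t) / v T)"
proof -
  define K where "K x u = indicator {0..x} u * (\<kappa> u)\<^sup>2" for x u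
  define e where "e = exp (qbar q s + qbar q t)"
  have K: "integrable lborel (K x)" "(LINT u|lborel. K x u) = v x" if "0 \<le> x" for x
    using lborel_integral_\<kappa>[OF that] unfolding K_def[abs_def] by auto
  have "(LINT u|lborel. anticipative_kernel s u * anticipative_kernel t u)
    = (LINT u|lborel. e * (1 - v t / v T) * K s u - e * (v s / v T) * K t u + e * (v s / v T) * (v t / v T) * K T u)"
    using assms by (intro Bochner_Integration.integral_cong refl)
      (auto simp: anticipative_kernel_def K_def e_def indicator_def exp_add power2_eq_square algebra_simps)
  also have "\<dots> = e * (1 - v t / v T) * v s - e * (v s / v T) * v t + e * (v s / v T) * (v t / v T) * v T"
    using K[of s] K[of t] K[of T] assms T by simp
  also have "\<dots> = e * (v s * (v T - v t) / v T)"
    using v_T_pos by (simp add: field_simps)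
  finally show ?thesis by (simp add: e_def)
qed

lemma inner_kernels_eq:
  assumes "s \<in> {0..T}" "t \<in> {0..T}"
  shows "(LINT u|lborel. anticipative_kernel s u * anticipative_kernel t u)
    = (LINT u|lborel. bridge_kernel s u * bridge_kernel t u)"
proof (cases "s \<le> t")
  case True
  then show ?thesis using assms inner_bridge_kernel[of s t] inner_anticipative_kernel[of s t] by simp
next
  case False
  then have "t \<le> s" by simp
  then show ?thesis using assms inner_bridge_kernel[of t s] inner_anticipative_kernel[of t s]
    by (simp add: mult.commute)
qed

section \<open>Weights and means expressed through the clock\<close>

lemma cond_var_ratio:
  assumes "t \<in> {0..T}"
  shows "cond_var q \<sigma> 0 t / cond_var q \<sigma> 0 T = exp (qbar q t)^2 / exp (qbar q T)^2 * (v t / v T)"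
  using assms T by (simp add: cond_var_eq exp_double)

lemma Rtilde_ratio:
  assumes "t \<in> {0..T}"
  shows "Rtilde q \<sigma> t T / Rtilde q \<sigma> 0 T = exp (qbar q t) * ((v T - v t) / v T)"
    and "Rtilde q \<sigma> 0 t / Rtilde q \<sigma> 0 T = exp (qbar q t) / exp (qbar q T) * (v t / v T)"
  using assms T v_T_pos
  by (simp_all add: Rtilde_def cond_var_eq exp_mult_2 exp_diff exp_minus field_simps power2_eq_square)

text \<open>Includes \<open>t = T\<close>, where the right side reduces to \<open>b\<close>; one
  mean function thus also serves the prescribed end value.\<close>

lemma bridge_mean_eq:
  assumes t: "t \<in> {0..T}"
  shows "bridge_mean q r \<sigma> T a b 0 t
    = exp (qbar q t) / exp (qbar q T) * (v t / v T) * (b - exp (qbar q T) * (\<rho> T - \<rho> t))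
      + (v T - v t) / v T * (exp (qbar q t) * (a + \<rho> t))"
proof -
  have m: "integral {t..T} (\<lambda>u. exp (qbar q T - qbar q u) * r u) = exp (qbar q T) * (\<rho> T - \<rho> t)"
  proof -
    have "(\<lambda>u. exp (- qbar q u) * r u) integrable_on {0..T}"
      by (intro integrable_continuous_interval continuous_intros cont_qbar continuous_on_subset[OF r]) auto
    from Henstock_Kurzweil_Integration.integral_combine[OF _ _ this, of t] t
    have "integral {t..T} (\<lambda>u. exp (- qbar q u) * r u) = \<rho> T - \<rho> t" by (simp add: \<rho>_def)
    then show ?thesis
      using cond_mean_eq[OF r, of t T 0] t by (simp add: cond_mean_def)
  qed
  have "cond_mean q r a 0 t = exp (qbar q t) * (a + \<rho> t)"
    using cond_mean_eq[OF r, of 0 t a] t by (simp add: \<rho>_def algebra_simps)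
  moreover have "cond_var q \<sigma> t T / cond_var q \<sigma> 0 T = (v T - v t) / v T"
    using t T by (simp add: cond_var_eq)
  moreover have "cond_var q \<sigma> 0 t / cond_var q \<sigma> 0 T * exp (qbar q T - qbar q t) = exp (qbar q t) / exp (qbar q T) * (v t / v T)"
    unfolding cond_var_ratio[OF t] by (simp add: exp_diff field_simps power2_eq_square)
  ultimately show ?thesis unfolding bridge_mean_def m by simp
qed

text \<open>Pure algebra for a single outcome: \<open>y\<close>, \<open>z\<close> and
  \<open>zT\<close> stand for the values of \<open>Y t\<close>, \<open>Z t\<close> and
  \<open>Z T\<close>.\<close>

lemma bridge_formula_explicit:
  assumes t: "t \<in> {0..T}" and z: "y = a * (Rtilde q \<sigma> t T / Rtilde q \<sigma> 0 T) + z - Rtilde q \<sigma> 0 t / Rtilde q \<sigma> 0 T * (zT - b)"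
  shows "y = a * (exp (qbar q t) - exp (2 * qbar q T - qbar q t) * (cond_var q \<sigma> 0 t / cond_var q \<sigma> 0 T))
        + b * exp (qbar q T - qbar q t) * (cond_var q \<sigma> 0 t / cond_var q \<sigma> 0 T)
        + (z - exp (qbar q T - qbar q t) * (cond_var q \<sigma> 0 t / cond_var q \<sigma> 0 T) * zT)"
proof -
  have h1: "exp (2 * qbar q T - qbar q t) * (cond_var q \<sigma> 0 t / cond_var q \<sigma> 0 T) = exp (qbar q t) * (v t / v T)"
    unfolding cond_var_ratio[OF t] by (simp add: exp_diff exp_mult_2 field_simps power2_eq_square)
  have h2: "exp (qbar q T - qbar q t) * (cond_var q \<sigma> 0 t / cond_var q \<sigma> 0 T) = exp (qbar q t) / exp (qbar q T) * (v t / v T)"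
    unfolding cond_var_ratio[OF t] by (simp add: exp_diff field_simps power2_eq_square)
  have h3: "b * exp (qbar q T - qbar q t) * (cond_var q \<sigma> 0 t / cond_var q \<sigma> 0 T)
     = b * (exp (qbar q T - qbar q t) * (cond_var q \<sigma> 0 t / cond_var q \<sigma> 0 T))" by simp
  have h4: "(v T - v t) / v T = 1 - v t / v T" using v_T_pos by (simp add: diff_divide_distrib)
  show ?thesis unfolding z Rtilde_ratio[OF t] h1 h3 h2 h4 by (simp add: algebra_simps diff_divide_distrib)
qed

end

section \<open>Equality in law, the covariance identity and the explicit formula\<close>

theorem theorem3p3:
  fixes M :: "'w measure"
    and B Z Y :: "real \<Rightarrow> 'w \<Rightarrow> real"
    and q r \<sigma> :: "real \<Rightarrow> real"
    and a b T :: real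
  assumes "continuous_on {0..} q" and "continuous_on {0..} r" and "continuous_on {0..} \<sigma>"
    and "\<And>t. 0 \<le> t \<Longrightarrow> \<sigma> t \<noteq> 0"
    and "0 < T"
    and "standard_wiener_process M B"
    and "linear_sde_solution M B q r \<sigma> Z"
    and "AE \<omega> in M. Z 0 \<omega> = 0"
    and Y_def: "\<And>t \<omega>. t \<in> {0..T} \<Longrightarrow> \<omega> \<in> space M \<Longrightarrow>
      Y t \<omega> = a * (Rtilde q \<sigma> t T / Rtilde q \<sigma> 0 T) + Z t \<omega>
        - Rtilde q \<sigma> 0 t / Rtilde q \<sigma> 0 T * (Z T \<omega> - b)"
  shows "(\<forall>U. linear_process_bridge M B q r \<sigma> T a b U \<longrightarrow> equal_in_law {0..T} M Y M U) \<and>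
    (\<forall>s t. 0 \<le> s \<and> s \<le> t \<and> t \<le> T \<longrightarrow>
      Rtilde q \<sigma> s t = exp (qbar q s - qbar q t) * covariance_fun M Z t t
        - exp (qbar q t - qbar q s) * covariance_fun M Z s s) \<and>
    (\<forall>t\<in>{0..T}. \<forall>\<omega>\<in>space M.
      Y t \<omega> = a * (exp (qbar q t)
            - exp (2 * qbar q T - qbar q t) * (cond_var q \<sigma> 0 t / cond_var q \<sigma> 0 T))
        + b * exp (qbar q T - qbar q t) * (cond_var q \<sigma> 0 t / cond_var q \<sigma> 0 T)
        + (Z t \<omega> - exp (qbar q T - qbar q t) * (cond_var q \<sigma> 0 t / cond_var q \<sigma> 0 T) * Z T \<omega>))"
proof (intro conjI allI impI ballI)
  interpret standard_wiener_process M B by fact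
  interpret bridge_coefficients q \<sigma> r T by unfold_locales fact+
  let ?V = "\<lambda>t \<omega>. exp (- qbar q t) * (Z t \<omega> - cond_mean q r 0 0 t)"
  have Zt: "wiener_pair (\<lambda>u. indicator {0..t} u * \<kappa> u) (?V t)" if "0 \<le> t" for t
    unfolding \<kappa>_def by (intro linear_sde_solution_wiener_pair assms that)
  have mean: "cond_mean q r 0 0 t = exp (qbar q t) * \<rho> t" if "0 \<le> t" for t
    using cond_mean_eq[OF r, of 0 t 0] that by (simp add: \<rho>_def)
  have [measurable]: "Z t \<in> borel_measurable M" if "0 \<le> t" for t
    using assms(7) that by (auto simp: linear_sde_solution_def)
  {
    fix t \<omega> assume "t \<in> {0..T}" "\<omega> \<in> space M"
    then show "Y t \<omega> = a * (exp (qbar q t)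
            - exp (2 * qbar q T - qbar q t) * (cond_var q \<sigma> 0 t / cond_var q \<sigma> 0 T))
        + b * exp (qbar q T - qbar q t) * (cond_var q \<sigma> 0 t / cond_var q \<sigma> 0 T)
        + (Z t \<omega> - exp (qbar q T - qbar q t) * (cond_var q \<sigma> 0 t / cond_var q \<sigma> 0 T) * Z T \<omega>)"
      by (intro bridge_formula_explicit Y_def)
  next
    fix s t assume st: "0 \<le> s \<and> s \<le> t \<and> t \<le> T"
    have cov: "covariance_fun M Z t t = exp (2 * qbar q t) * v t" if t: "0 \<le> t" for t
    proof -
      note mom = wiener_pair_moments[OF Zt[OF t]]
      have ZV: "Z t \<omega> = exp (qbar q t) * ?V t \<omega> + cond_mean q r 0 0 t" for \<omega>
        by (simp add: exp_minus field_simps)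
      have "(LINT \<omega>|M. Z t \<omega>) = (LINT \<omega>|M. exp (qbar q t) * ?V t \<omega> + cond_mean q r 0 0 t)"
        by (subst ZV) (rule refl)
      also have "\<dots> = exp (qbar q t) * (LINT \<omega>|M. ?V t \<omega>) + cond_mean q r 0 0 t"
        using mom(1) by (simp add: prob_space del: integral_mult_right_zero)
      finally have "(LINT \<omega>|M. Z t \<omega>) = cond_mean q r 0 0 t" unfolding mom(2) by simp
      moreover have "(Z t \<omega> - c) * (Z t \<omega> - c) = exp (2 * qbar q t) * (exp (- qbar q t) * (Z t \<omega> - c))\<^sup>2" for c \<omega>
        by (simp add: power_mult_distrib power2_eq_square flip: exp_add mult.assoc)
      ultimately have "covariance_fun M Z t t = (LINT \<omega>|M. exp (2 * qbar q t) * (?V t \<omega>)\<^sup>2)"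
        unfolding covariance_fun_def by (simp only:)
      also have "\<dots> = exp (2 * qbar q t) * (LINT u|lborel. (indicator {0..t} u * \<kappa> u)\<^sup>2)"
        using mom(3) by simp
      also have "(LINT u|lborel. (indicator {0..t} u * \<kappa> u)\<^sup>2) = (LINT u|lborel. indicator {0..t} u * (\<kappa> u)\<^sup>2)"
        by (intro Bochner_Integration.integral_cong refl) (auto simp: indicator_def)
      finally show ?thesis using lborel_integral_\<kappa>(2)[OF t] by simp
    qed
    \<comment> \<open>With the variance from \<open>cov\<close>, both sides equal
      \<open>exp (qbar q s + qbar q t) * (v t - v s)\<close>.\<close>
    show "Rtilde q \<sigma> s t = exp (qbar q s - qbar q t) * covariance_fun M Z t t
        - exp (qbar q t - qbar q s) * covariance_fun M Z s s"
      using st by (simp add: cov Rtilde_def cond_var_eq exp_mult_2 exp_diff field_simps power2_eq_square)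
  next
    fix U assume U: "linear_process_bridge M B q r \<sigma> T a b U"
    let ?n = "bridge_mean q r \<sigma> T a b 0"
    have Um[measurable]: "U t \<in> borel_measurable M" if "t \<in> {0..T}" for t
      using U that by (simp add: linear_process_bridge_def)
    have Ym: "Y t \<in> borel_measurable M" if "t \<in> {0..T}" for t
    proof -
      have "0 \<le> t" "0 \<le> T" using that by auto
      then have "(\<lambda>\<omega>. a * (Rtilde q \<sigma> t T / Rtilde q \<sigma> 0 T) + Z t \<omega>
        - Rtilde q \<sigma> 0 t / Rtilde q \<sigma> 0 T * (Z T \<omega> - b)) \<in> borel_measurable M" by measurable
      then show ?thesis using Y_def[OF that] by (simp cong: measurable_cong)
    qed
    have Yp: "wiener_pair (anticipative_kernel t) (\<lambda>\<omega>. Y t \<omega> - ?n t)" if t: "t \<in> {0..T}" for t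
    proof (rule wiener_pair_cong_AE)
      have t0: "0 \<le> t" "0 \<le> T" using t by auto
      show 1: "wiener_pair (anticipative_kernel t)
          (\<lambda>\<omega>. exp (qbar q t) * ?V t \<omega> - exp (qbar q t) * (v t / v T) * ?V T \<omega>)"
        unfolding anticipative_kernel_def[abs_def]
        by (intro wiener_pair_diff wiener_pair_scale Zt t0)
      show "anticipative_kernel t \<in> borel_measurable lborel" by (rule wiener_pair_measurable[OF 1])
      show "(\<lambda>\<omega>. Y t \<omega> - ?n t) \<in> borel_measurable M" using Ym[OF t] by simp
      \<comment> \<open>The constants match: the terms with \<open>a\<close> and \<open>b\<close>
        agree, and the means \<open>\<rho> t\<close> and \<open>\<rho> T\<close> enter
        \<open>Y t\<close> through \<open>Z t\<close> and \<open>Z T\<close> with the same weights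
        as in the bridge mean.\<close>
      show "AE \<omega> in M. exp (qbar q t) * ?V t \<omega> - exp (qbar q t) * (v t / v T) * ?V T \<omega> = Y t \<omega> - ?n t"
      proof (rule AE_I2)
        fix \<omega> assume \<omega>: "\<omega> \<in> space M"
        show "exp (qbar q t) * ?V t \<omega> - exp (qbar q t) * (v t / v T) * ?V T \<omega> = Y t \<omega> - ?n t"
          unfolding Y_def[OF t \<omega>] Rtilde_ratio[OF t] bridge_mean_eq[OF t] mean[OF t0(1)] mean[OF t0(2)]
          using v_T_pos by (simp add: exp_minus field_simps)
      qed
    qed simp
    have Up: "wiener_pair (bridge_kernel t) (\<lambda>\<omega>. U t \<omega> - ?n t)" if t: "t \<in> {0..T}" for t
    proof (cases "t = T")
      \<comment> \<open>The integral representation of \<open>U\<close> stops short of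
        \<open>T\<close>; there the prescribed value \<open>b\<close> equals the mean and the kernel
        is zero.\<close>
      case True
      have "AE \<omega> in M. U T \<omega> = b" using U by (simp add: linear_process_bridge_def)
      moreover have "?n T = b"
        using bridge_mean_eq[of T a b] T v_T_pos by simp
      ultimately have "AE \<omega> in M. 0 = U T \<omega> - ?n T" by auto
      moreover have "bridge_kernel T = (\<lambda>_. 0)" by (simp add: fun_eq_iff bridge_kernel_def)
      ultimately show ?thesis
        using wiener_pair_cong_AE[OF wiener_pair_zero, of "\<lambda>_. 0" "\<lambda>\<omega>. U T \<omega> - ?n T"] Um[of T] T True by simp
    next
      case False
      with t have t': "0 \<le> t" "t < T" and "t \<in> {0..<T}" by auto
      obtain I where I: "has_wiener_integral M B (\<lambda>s. cond_var q \<sigma> t T / cond_var q \<sigma> s T * exp (qbar q t - qbar q s) * \<sigma> s) t I"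
        and UI: "AE \<omega> in M. U t \<omega> = ?n t + I \<omega>"
        using U \<open>t \<in> {0..<T}\<close> unfolding linear_process_bridge_def by blast
      \<comment> \<open>In the quotient of conditional variances the common factor
        \<open>exp (2 * qbar q T)\<close> cancels, leaving
        \<open>(v T - v t) / (v T - v u)\<close>.\<close>
      have eq: "(\<lambda>u. indicator {0..t} u * (cond_var q \<sigma> t T / cond_var q \<sigma> u T * exp (qbar q t - qbar q u) * \<sigma> u))
        = bridge_kernel t"
        using t' by (auto simp: fun_eq_iff bridge_kernel_def indicator_def cond_var_eq \<kappa>_def exp_diff exp_minus inverse_eq_divide)
      \<comment> \<open>Since \<open>t < T\<close>, the singularity of the kernel at
        \<open>T\<close> stays outside the range of integration, so the kernel is continuous
        there.\<close>
      have "v T - v u \<noteq> 0" if "u \<in> {0..t}" for u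
        using v_less[of u T] that t' by simp
      then have meas: "bridge_kernel t \<in> borel_measurable lborel"
        unfolding bridge_kernel_def[abs_def]
        by (intro indicator_mult_borel continuous_intros cont_v cont_\<kappa>) auto
      have "wiener_pair (bridge_kernel t) I"
        using meas has_wiener_integral_wiener_pair[OF I] unfolding eq by simp
      then show ?thesis
        by (rule wiener_pair_cong_AE) (use UI Um[OF t] meas in auto)
    qed
    show "equal_in_law {0..T} M Y M U"
      unfolding equal_in_law_def
    proof (intro conjI ballI allI impI Ym Um)
      fix J :: "real set" assume J: "finite J \<and> J \<subseteq> {0..T}"
      show "distr M (\<Pi>\<^sub>M t\<in>J. borel) (\<lambda>\<omega>. \<lambda>t\<in>J. Y t \<omega>) = distr M (\<Pi>\<^sub>M t\<in>J. borel) (\<lambda>\<omega>. \<lambda>t\<in>J. U t \<omega>)"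
        by (rule wiener_pair_equal_law[where f=anticipative_kernel and g=bridge_kernel and n="?n"])
           (use J in \<open>auto intro!: Yp Up inner_kernels_eq\<close>)
    qed
  }
qed

end
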